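(* Let $0\to G'\to G\to G''\to 0$ be a short exact sequence of finite abelian groups with $G''$ nontrivial, let $0\to A''\to A\to A'\to 0$ be the corresponding short exact sequence of character groups, and let $n=n'+n''$ with $n',n''\ge1$. The assignment on generators $$\Delta:\ \langle a_1,\dots,a_n\rangle\mapsto\sum\ \langle a_{I'}\bmod A''\rangle\otimes\langle a_{I''}\rangle^-,$$ where the sum is over all subdivisions $\{1,\dots,n\}=I'\sqcup I''$ with $\#I'=n'$, $\#I''=n''$ such that $a_j\in A''$ for all $j\in I''$ and the elements $a_j$, $j\in I''$, generate $A''$, extends to a well-defined $\mathbb Z$-linear homomorphism $$\Delta:\mathcal M_{n}(G)\to\mathcal M_{n'}(G')\otimes\mathcal M^-_{n''}(G'').$$
   Context: For a finite abelian group $G$ with character group $A=\mathrm{Hom}(G,\mathbb C^\times)$ (written additively) and $n\ge1$, $\mathcal M_n(G)$ is the $\mathbb Z$-module generated by symbols $\langle a_1,\dots,a_n\rangle$ with $a_i\in A$ and $\sum_i\mathbb Z a_i=A$, subject to the relations: (S) $\langle a_{\sigma(1)},\dots,a_{\sigma(n)}\rangle=\langle a_1,\dots,a_n\rangle$ for all $\sigma\in\mathfrak S_n$; (M) for all $2\le k\le n$, all $a_1,\dots,a_k\in A$ and all $b_1,\dots,b_{n-k}\in A$ with $\sum_i\mathbb Z a_i+\sum_j\mathbb Z b_j=A$: $$\langle a_1,\dots,a_k,b_1,\dots,b_{n-k}\rangle=\sum_{1\le i\le k}\langle a_1-a_i,\dots,a_i,\dots,a_k-a_i,b_1,\dots,b_{n-k}\rangle,$$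 where in the $i$-th summand the $i$-th entry is $a_i$ and for $j\le k$, $j\ne i$, the $j$-th entry is $a_j-a_i$. (For $n=1$ there are no relations: $\mathcal M_1(G)$ is free on the symbols $\langle a\rangle$ with $a$ a generator of $A$; it is $0$ if $G$ is not cyclic.) For $G$ nontrivial, $\mathcal M_n^-(G)$ is the quotient of $\mathcal M_n(G)$ by the relations $\langle -a_1,a_2,\dots,a_n\rangle=-\langle a_1,a_2,\dots,a_n\rangle$; the image of $\langle a_1,\dots,a_n\rangle$ is denoted $\langle a_1,\dots,a_n\rangle^-$. Notation: for $I'=\{i_1,\dots,i_{n'}\}$, $\langle a_{I'}\bmod A''\rangle=\langle a_{i_1}\bmod A'',\dots,a_{i_{n'}}\bmod A''\rangle\in\mathcal M_{n'}(G')$, where $a\bmod A''$ denotes the image of $a$ in $A'=A/A''$; similarly $\langle a_{I''}\rangle^-\in\mathcal M_{n''}^-(G'')$ is the symbol formed by the $a_j\in A''$, $j\in I''$. The order of the entries is irrelevant by (S). *)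

theory Defs
  imports "HOL-Algebra.Algebra" "HOL-Combinatorics.Combinatorics"
begin

text \<open>
  Abelian groups are given by \<open>comm_group\<close> and so are written multiplicatively:
  \<open>x \<otimes> inv y\<close> is \<open>x - y\<close> and \<open>finprod\<close> is a sum.  A \<open>\<int>\<close>-module is an abelian
  group, and a \<open>\<int>\<close>-linear map is a group homomorphism.
\<close>

section \<open>Characters\<close>

definition complex_units :: "complex monoid" where
  "complex_units = \<lparr>carrier = - {0}, monoid.mult = (*), one = 1\<rparr>"

text \<open>Extensionality makes equality of characters equality of their values on \<open>carrier G\<close>.\<close>

definition char_group :: "('g, 'x) monoid_scheme \<Rightarrow> ('g \<Rightarrow> complex) monoid" where
  "char_group G =
     \<lparr>carrier = hom G complex_units \<inter> extensional (carrier G),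
      monoid.mult = (\<lambda>\<chi> \<psi>. \<lambda>x\<in>carrier G. \<chi> x * \<psi> x),
      one = (\<lambda>x\<in>carrier G. 1)\<rparr>"

text \<open>
  The homomorphism \<open>char_group H \<rightarrow> char_group G\<close> dual to \<open>f : G \<rightarrow> H\<close>.
\<close>

definition dual_map ::
  "('g, 'x) monoid_scheme \<Rightarrow> ('g \<Rightarrow> 'h) \<Rightarrow> ('h \<Rightarrow> complex) \<Rightarrow> 'g \<Rightarrow> complex" where
  "dual_map G f \<chi> = (\<lambda>x\<in>carrier G. \<chi> (f x))"


section \<open>The groups of symbols\<close>

definition generating_tuples :: "nat \<Rightarrow> ('c, 'x) monoid_scheme \<Rightarrow> 'c list set" where
  "generating_tuples n A =
     {as. length as = n \<and> set as \<subseteq> carrier A \<and> generate A (set as) = carrier A}"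

definition perm_relators :: "nat \<Rightarrow> ('c, 'x) monoid_scheme \<Rightarrow> ('c list \<Rightarrow>\<^sub>0 int) set" where
  "perm_relators n A =
     {frag_of (permute_list \<sigma> as) - frag_of as | \<sigma> as.
        \<sigma> permutes {..<n} \<and> as \<in> generating_tuples n A}"

definition shift_entries :: "('c, 'x) monoid_scheme \<Rightarrow> 'c list \<Rightarrow> nat \<Rightarrow> 'c list" where
  "shift_entries A as i =
     map (\<lambda>j. if j = i then as ! i else as ! j \<otimes>\<^bsub>A\<^esub> inv\<^bsub>A\<^esub> (as ! i)) [0..<length as]"

definition blowup_relators :: "nat \<Rightarrow> ('c, 'x) monoid_scheme \<Rightarrow> ('c list \<Rightarrow>\<^sub>0 int) set" where
  "blowup_relators n A =
     {frag_of (as @ bs) - (\<Sum>i<length as. frag_of (shift_entries A as i @ bs)) | as bs.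
        2 \<le> length as \<and> as @ bs \<in> generating_tuples n A}"

definition symbol_relations ::
  "nat \<Rightarrow> ('g, 'x) monoid_scheme \<Rightarrow> (('g \<Rightarrow> complex) list \<Rightarrow>\<^sub>0 int) set" where
  "symbol_relations n G =
     generate (free_Abelian_group (generating_tuples n (char_group G)))
       (perm_relators n (char_group G) \<union> blowup_relators n (char_group G))"

definition symbol_group ::
  "nat \<Rightarrow> ('g, 'x) monoid_scheme \<Rightarrow> (('g \<Rightarrow> complex) list \<Rightarrow>\<^sub>0 int) set monoid"
  (\<open>\<M>\<close>) where
  "\<M> n G =
     free_Abelian_group (generating_tuples n (char_group G)) Mod symbol_relations n G"

definition symbol ::
  "nat \<Rightarrow> ('g, 'x) monoid_scheme \<Rightarrow> ('g \<Rightarrow> complex) list \<Rightarrow>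
     (('g \<Rightarrow> complex) list \<Rightarrow>\<^sub>0 int) set" where
  "symbol n G as =
     symbol_relations n G #>\<^bsub>free_Abelian_group (generating_tuples n (char_group G))\<^esub> frag_of as"

text \<open>
  The sum in the generating set is the relator of
  \<open>\<langle>-a\<^sub>1, a\<^sub>2, \<dots>, a\<^sub>n\<rangle> = -\<langle>a\<^sub>1, a\<^sub>2, \<dots>, a\<^sub>n\<rangle>\<close>.
\<close>

definition minus_relations ::
  "nat \<Rightarrow> ('g, 'x) monoid_scheme \<Rightarrow> (('g \<Rightarrow> complex) list \<Rightarrow>\<^sub>0 int) set set" where
  "minus_relations n G =
     generate (\<M> n G)
       {symbol n G (inv\<^bsub>char_group G\<^esub> a # as) \<otimes>\<^bsub>\<M> n G\<^esub> symbol n G (a # as) | a as.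
          a # as \<in> generating_tuples n (char_group G)}"

definition minus_symbol_group ::
  "nat \<Rightarrow> ('g, 'x) monoid_scheme \<Rightarrow> (('g \<Rightarrow> complex) list \<Rightarrow>\<^sub>0 int) set set monoid"
  (\<open>\<M>\<^sup>-\<close>) where
  "\<M>\<^sup>- n G = \<M> n G Mod minus_relations n G"

definition minus_symbol ::
  "nat \<Rightarrow> ('g, 'x) monoid_scheme \<Rightarrow> ('g \<Rightarrow> complex) list \<Rightarrow>
     (('g \<Rightarrow> complex) list \<Rightarrow>\<^sub>0 int) set set" where
  "minus_symbol n G as = minus_relations n G #>\<^bsub>\<M> n G\<^esub> symbol n G as"


section \<open>Tensor products over the integers\<close>

definition tensor_relations ::
  "('a, 'x) monoid_scheme \<Rightarrow> ('b, 'y) monoid_scheme \<Rightarrow> ('a \<times> 'b \<Rightarrow>\<^sub>0 int) set" where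
  "tensor_relations M N =
     generate (free_Abelian_group (carrier M \<times> carrier N))
       ({frag_of (x \<otimes>\<^bsub>M\<^esub> x', y) - frag_of (x, y) - frag_of (x', y) | x x' y.
           x \<in> carrier M \<and> x' \<in> carrier M \<and> y \<in> carrier N} \<union>
        {frag_of (x, y \<otimes>\<^bsub>N\<^esub> y') - frag_of (x, y) - frag_of (x, y') | x y y'.
           x \<in> carrier M \<and> y \<in> carrier N \<and> y' \<in> carrier N})"

definition tensor_group ::
  "('a, 'x) monoid_scheme \<Rightarrow> ('b, 'y) monoid_scheme \<Rightarrow> ('a \<times> 'b \<Rightarrow>\<^sub>0 int) set monoid"
  (infixl \<open>\<otimes>\<^sub>\<int>\<close> 70) where
  "M \<otimes>\<^sub>\<int> N = free_Abelian_group (carrier M \<times> carrier N) Mod tensor_relations M N"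

definition tensor_elem ::
  "('a, 'x) monoid_scheme \<Rightarrow> ('b, 'y) monoid_scheme \<Rightarrow> 'a \<Rightarrow> 'b \<Rightarrow>
     ('a \<times> 'b \<Rightarrow>\<^sub>0 int) set" where
  "tensor_elem M N x y =
     tensor_relations M N #>\<^bsub>free_Abelian_group (carrier M \<times> carrier N)\<^esub> frag_of (x, y)"


section \<open>The comultiplication on symbols\<close>

text \<open>
  Positions are numbered from \<open>0\<close>.  \<open>A''\<close> is identified with a subgroup \<open>B\<close> of \<open>A\<close>.
\<close>

definition subdivisions ::
  "nat \<Rightarrow> nat \<Rightarrow> ('c, 'x) monoid_scheme \<Rightarrow> 'c set \<Rightarrow> 'c list \<Rightarrow> (nat set \<times> nat set) set" where
  "subdivisions n' n'' A B as =
     {(I', I''). I' \<union> I'' = {..<length as} \<and> I' \<inter> I'' = {} \<and> card I' = n' \<and> card I'' = n'' \<and>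
        (\<forall>j\<in>I''. as ! j \<in> B) \<and> generate A ((!) as ` I'') = B}"

text \<open>
  For \<open>i : G' \<rightarrow> G\<close> and \<open>p : G \<rightarrow> G''\<close>, \<open>dual_map G' i\<close> is the restriction
  \<open>A \<rightarrow> A'\<close>, and \<open>dual_map G p\<close> is the inclusion \<open>A'' \<rightarrow> A\<close>, which has to be
  inverted on the entries \<open>a\<^sub>j\<close>, \<open>j \<in> I''\<close>, to obtain characters of \<open>G''\<close>.
\<close>

definition Delta_symbol ::
  "nat \<Rightarrow> nat \<Rightarrow> ('a, 'x) monoid_scheme \<Rightarrow> ('b, 'y) monoid_scheme \<Rightarrow> ('c, 'z) monoid_scheme \<Rightarrow>
     ('a \<Rightarrow> 'b) \<Rightarrow> ('b \<Rightarrow> 'c) \<Rightarrow> ('b \<Rightarrow> complex) list \<Rightarrow>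
     ((('a \<Rightarrow> complex) list \<Rightarrow>\<^sub>0 int) set \<times> (('c \<Rightarrow> complex) list \<Rightarrow>\<^sub>0 int) set set \<Rightarrow>\<^sub>0 int) set"
  where
  "Delta_symbol n' n'' G' G G'' i p as =
     finprod (\<M> n' G' \<otimes>\<^sub>\<int> \<M>\<^sup>- n'' G'')
       (\<lambda>(I', I'').
          tensor_elem (\<M> n' G') (\<M>\<^sup>- n'' G'')
            (symbol n' G' (map (dual_map G' i) (nths as I')))
            (minus_symbol n'' G''
               (map (inv_into (carrier (char_group G'')) (dual_map G p)) (nths as I''))))
       (subdivisions n' n'' (char_group G) (dual_map G p ` carrier (char_group G'')) as)"

end

theory Submission
  imports Defs
begin

text \<open>
  Since the relations (M) follow from (S) and their case \<open>k = 2\<close>, only the relation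
  \<open>\<langle>a, b, \<dots>\<rangle> = \<langle>a, b - a, \<dots>\<rangle> + \<langle>a - b, b, \<dots>\<rangle>\<close> has to be checked.  Subdivisions with
  \<open>a\<close> and \<open>b\<close> on the same side match by the relation in that tensor factor.  The term of
  \<open>\<langle>a, b, \<dots>\<rangle>\<close> with only \<open>b\<close> in \<open>I''\<close> equals the corresponding term of \<open>\<langle>a - b, b, \<dots>\<rangle>\<close>,
  because \<open>b \<in> A''\<close>, and symmetrically for \<open>a\<close>.  The two remaining families, with
  \<open>b - a\<close> respectively \<open>a - b\<close> in \<open>I''\<close>, cancel: there \<open>a\<close> and \<open>b\<close> agree modulo \<open>A''\<close>, and
  the second factors are opposite in \<open>\<M>\<^sup>-\<close>.  That \<open>a\<^bsub>I'\<^esub> mod A''\<close> generates \<open>A'\<close> uses that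
  characters of \<open>G'\<close> extend to \<open>G\<close>.
\<close>

section \<open>Quotients and tensor products\<close>

text \<open>The sum defining the map runs over sets of positions that satisfy conditions on the
  entries, and the three tuples in the relation have different entries, hence different sets of
  admissible positions. Two devices make the sums comparable. Each summand is made total, with the
  neutral value wherever the conditions fail, so that all three sums run over all splittings of a
  list. The sum is then rewritten as a recursion on the list, which peels off the two leading
  entries. For each splitting (U, V) of the common remaining entries, the relation becomes an
  identity between twelve elements of the tensor product, four for each tuple, and it can be checked
  for one (U, V) at a time. Symmetry is handled by multisets: a function of tuples that depends only
  on the multiset of entries respects (S). Characters extend because every complex number has m-th
  roots, which supplies the value on an element newly adjoined to a subgroup.\<close>

lemma (in comm_group) generate_normal:
  "R \<subseteq> carrier G \<Longrightarrow> generate G R \<lhd> G"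
  by (simp add: generate_is_subgroup normal_iff_subgroup)

lemma (in comm_group) comm_group_Mod_generate:
  "R \<subseteq> carrier G \<Longrightarrow> comm_group (G Mod generate G R)"
  by (simp add: abelian_FactGroup generate_is_subgroup)

lemma (in comm_group) coset_hom_Mod_generate:
  "R \<subseteq> carrier G \<Longrightarrow> (\<lambda>x. generate G R #> x) \<in> hom G (G Mod generate G R)"
  using generate_normal normal.r_coset_hom_Mod by blast

text \<open>The form in which relators are used, for symbols as well as for tensors. Only
  \<open>v\<close> has to be known to lie in the free group; \<open>u = (u - v) + v\<close> then
  does so too.\<close>

lemma free_Abelian_group_coset_eq:
  assumes R: "R \<subseteq> carrier (free_Abelian_group S)" and "u - v \<in> R"
    and v: "v \<in> carrier (free_Abelian_group S)"
  shows "generate (free_Abelian_group S) R #>\<^bsub>free_Abelian_group S\<^esub> u =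
    generate (free_Abelian_group S) R #>\<^bsub>free_Abelian_group S\<^esub> v"
proof -
  let ?F = "free_Abelian_group S"
  interpret F: comm_group ?F by (rule abelian_free_Abelian_group)
  have sub: "subgroup (generate ?F R) ?F" by (rule F.generate_is_subgroup [OF R])
  have uv: "u - v \<in> generate ?F R" by (rule generate.incl [OF assms(2)])
  have "generate ?F R #>\<^bsub>?F\<^esub> u = generate ?F R #>\<^bsub>?F\<^esub> ((u - v) \<otimes>\<^bsub>?F\<^esub> v)"
    by simp
  also have "\<dots> = generate ?F R #>\<^bsub>?F\<^esub> (u - v) #>\<^bsub>?F\<^esub> v"
    using F.coset_mult_assoc [of "generate ?F R" "u - v" v] sub uv v subgroup.subset subgroup.mem_carrier
    by metis
  also have "generate ?F R #>\<^bsub>?F\<^esub> (u - v) = generate ?F R"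
    by (rule F.coset_join2 [OF subgroup.mem_carrier [OF sub uv] sub uv])
  finally show ?thesis .
qed

lemma (in group) generate_eqI:
  assumes "S \<subseteq> carrier G" "S' \<subseteq> carrier G" "S \<subseteq> generate G S'" "S' \<subseteq> generate G S"
  shows "generate G S = generate G S'"
  using assms generate_subgroup_incl generate_is_subgroup by (meson subset_antisym)

lemma hom_unique_free_Abelian_group:
  assumes "group T" "f \<in> hom (free_Abelian_group S) T" "g \<in> hom (free_Abelian_group S) T"
    and eq: "\<And>s. s \<in> S \<Longrightarrow> f (frag_of s) = g (frag_of s)"
    and x: "x \<in> carrier (free_Abelian_group S)"
  shows "f x = g x"
proof -
  let ?F = "free_Abelian_group S"
  interpret f: group_hom ?F T f
    by (intro group_hom.intro group_hom_axioms.intro assms group_free_Abelian_group)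
  interpret g: group_hom ?F T g
    by (intro group_hom.intro group_hom_axioms.intro assms group_free_Abelian_group)
  show ?thesis
  proof (rule free_Abelian_group_induct [of x S])
    show "Poly_Mapping.keys x \<subseteq> S" using x by simp
    show "f 0 = g 0" using f.hom_one g.hom_one by simp
  next
    fix x y assume xy: "Poly_Mapping.keys x \<subseteq> S" "Poly_Mapping.keys y \<subseteq> S" "f x = g x" "f y = g y"
    then have "x - y = x \<otimes>\<^bsub>?F\<^esub> inv\<^bsub>?F\<^esub> y" by simp
    moreover have "x \<in> carrier ?F" "y \<in> carrier ?F" using xy by simp_all
    then have "f (x \<otimes>\<^bsub>?F\<^esub> inv\<^bsub>?F\<^esub> y) = g (x \<otimes>\<^bsub>?F\<^esub> inv\<^bsub>?F\<^esub> y)"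
      using xy(3,4) by (metis f.G.inv_closed f.hom_mult f.hom_inv g.hom_inv g.hom_mult)
    ultimately show "f (x - y) = g (x - y)" by (simp only:)
  qed (rule eq)
qed

text \<open>Universal property of a group given by generators and relators. The premise
  \<open>rel\<close> speaks of an arbitrary \<open>h\<close> extending \<open>f\<close>, because the
  homomorphism out of the free group is only known to exist; a caller may compute with its values on
  generators alone. Extensionality is what makes \<open>D\<close> unique as a total function of
  HOL.\<close>

lemma presentation_universal:
  assumes T: "comm_group T" and R: "R \<subseteq> carrier (free_Abelian_group S)"
    and f: "\<And>s. s \<in> S \<Longrightarrow> f s \<in> carrier T"
    and rel: "\<And>h r. h \<in> hom (free_Abelian_group S) T \<Longrightarrow> (\<And>s. s \<in> S \<Longrightarrow> h (frag_of s) = f s) \<Longrightarrow>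
      r \<in> R \<Longrightarrow> h r = \<one>\<^bsub>T\<^esub>"
  defines "Q \<equiv> free_Abelian_group S Mod generate (free_Abelian_group S) R"
  shows "\<exists>!D. D \<in> hom Q T \<and> D \<in> extensional (carrier Q) \<and>
    (\<forall>s\<in>S. D (generate (free_Abelian_group S) R #>\<^bsub>free_Abelian_group S\<^esub> frag_of s) = f s)"
proof -
  let ?F = "free_Abelian_group S" and ?N = "generate (free_Abelian_group S) R"
  interpret T: comm_group T by fact
  interpret F: comm_group ?F by (rule abelian_free_Abelian_group)
  have N: "?N \<lhd> ?F" using F.generate_normal [OF R] .
  have Q: "comm_group Q" unfolding Q_def by (rule F.comm_group_Mod_generate [OF R])
  then interpret Q: comm_group Q .
  have cos: "(\<lambda>x. ?N #>\<^bsub>?F\<^esub> x) \<in> hom ?F Q"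
    unfolding Q_def by (rule F.coset_hom_Mod_generate [OF R])
  obtain h where h: "h \<in> hom ?F T" "\<And>s. s \<in> S \<Longrightarrow> h (frag_of s) = f s"
    using T.free_Abelian_group_universal [of f S] f by (metis image_subsetI)
  interpret h: group_hom ?F T h
    by (intro group_hom.intro group_hom_axioms.intro h T.group_axioms F.group_axioms)
  \<comment> \<open>Since the kernel is a subgroup, killing the relators kills all they generate,
    and \<open>h\<close> descends to the quotient.\<close>
  have "R \<subseteq> kernel ?F T h"
    unfolding kernel_def using rel [OF h] R by blast
  then have "?N \<subseteq> kernel ?F T h"
    using F.generate_subgroup_incl h.subgroup_kernel by blast
  then obtain g where g: "g \<in> hom Q T" "\<And>x. x \<in> carrier ?F \<Longrightarrow> g (?N #>\<^bsub>?F\<^esub> x) = h x"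
    unfolding Q_def using h.FactGroup_universal_kernel [OF N] by blast
  have cosF: "?N #>\<^bsub>?F\<^esub> x \<in> carrier Q" if "x \<in> carrier ?F" for x
    using cos that by (rule hom_in_carrier)
  show ?thesis
  proof (rule ex1I [of _ "restrict g (carrier Q)"], intro conjI ballI)
    show "restrict g (carrier Q) \<in> hom Q T"
      using g(1) by (simp add: restrict_def)
    show "restrict g (carrier Q) \<in> extensional (carrier Q)" by simp
    show "restrict g (carrier Q) (?N #>\<^bsub>?F\<^esub> frag_of s) = f s" if s: "s \<in> S" for s
    proof -
      have "frag_of s \<in> carrier ?F" using s by simp
      then show ?thesis by (simp only: restrict_apply' cosF g(2) h(2) s)
    qed
  next
    fix D assume D: "D \<in> hom Q T \<and> D \<in> extensional (carrier Q) \<and> (\<forall>s\<in>S. D (?N #>\<^bsub>?F\<^esub> frag_of s) = f s)"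
    have "D c = restrict g (carrier Q) c" if c: "c \<in> carrier Q" for c
    proof -
      obtain x where x: "x \<in> carrier ?F" "c = ?N #>\<^bsub>?F\<^esub> x"
        using c unfolding Q_def carrier_FactGroup by blast
      have "(D \<circ> (\<lambda>x. ?N #>\<^bsub>?F\<^esub> x)) x = h x"
      proof (rule hom_unique_free_Abelian_group [OF T.group_axioms])
        show "D \<circ> (\<lambda>x. ?N #>\<^bsub>?F\<^esub> x) \<in> hom ?F T"
          using Group.hom_compose [OF cos] D by blast
      qed (use D h(2) in \<open>simp_all add: h(1) x(1) del: carrier_free_Abelian_group_iff\<close>)
      then show ?thesis
        by (simp only: restrict_apply' c o_apply x(2) [symmetric]) (simp only: x g(2))
    qed
    then show "D = restrict g (carrier Q)"
      using D by (intro extensionalityI [OF _ restrict_extensional]) auto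
  qed
qed

section \<open>Bilinearity of the tensor product over the integers\<close>

context
  fixes M :: "('a, 'x) monoid_scheme" and N :: "('b, 'y) monoid_scheme"
  assumes M: "comm_group M" and N: "comm_group N"
begin

interpretation M: comm_group M by (rule M)
interpretation N: comm_group N by (rule N)

private abbreviation (input) "F \<equiv> free_Abelian_group (carrier M \<times> carrier N)"

private abbreviation (input) "bilinear_relators \<equiv>
  {frag_of (x \<otimes>\<^bsub>M\<^esub> x', y) - frag_of (x, y) - frag_of (x', y) | x x' y.
           x \<in> carrier M \<and> x' \<in> carrier M \<and> y \<in> carrier N} \<union>
        {frag_of (x, y \<otimes>\<^bsub>N\<^esub> y') - frag_of (x, y) - frag_of (x, y') | x y y'.
           x \<in> carrier M \<and> y \<in> carrier N \<and> y' \<in> carrier N}"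

interpretation F: comm_group F by (rule abelian_free_Abelian_group)

private lemma bilinear_relators_closed: "bilinear_relators \<subseteq> carrier F"
proof -
  have diff: "a - b \<in> carrier F" if "a \<in> carrier F" "b \<in> carrier F" for a b
    using that keys_diff by fastforce
  have "frag_of (x, y) \<in> carrier F" if "x \<in> carrier M" "y \<in> carrier N" for x y
    using that by simp
  then show ?thesis
    by (intro subsetI, elim UnE CollectE exE conjE, simp_all only:)
      (intro diff; simp)+
qed

lemma comm_group_tensor: "comm_group (M \<otimes>\<^sub>\<int> N)"
  unfolding tensor_group_def tensor_relations_def
  by (rule F.comm_group_Mod_generate [OF bilinear_relators_closed])

lemma tensor_elem_closed:
  assumes "x \<in> carrier M" "y \<in> carrier N"
  shows "tensor_elem M N x y \<in> carrier (M \<otimes>\<^sub>\<int> N)"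
  unfolding tensor_group_def tensor_relations_def tensor_elem_def
  by (rule hom_in_carrier [OF F.coset_hom_Mod_generate [OF bilinear_relators_closed]])
    (use assms in simp)

text \<open>Stated for pairs \<open>u\<close>, \<open>v\<close>, \<open>w\<close>, so that one
  argument serves both families of relators, additivity on the left and on the right.\<close>

private lemma tensor_relatorD:
  assumes r: "frag_of u - (frag_of v + frag_of w) \<in> bilinear_relators"
    and vw: "v \<in> carrier M \<times> carrier N" "w \<in> carrier M \<times> carrier N"
  shows "tensor_elem M N (fst u) (snd u) =
    tensor_elem M N (fst v) (snd v) \<otimes>\<^bsub>M \<otimes>\<^sub>\<int> N\<^esub> tensor_elem M N (fst w) (snd w)"
proof -
  let ?R = bilinear_relators
  let ?q = "\<lambda>x. generate F ?R #>\<^bsub>F\<^esub> x"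
  have c: "frag_of v \<in> carrier F" "frag_of w \<in> carrier F"
    using vw by simp_all
  have "?q (frag_of u) = ?q (frag_of v + frag_of w)"
    using F.m_closed [OF c] 
    by (intro free_Abelian_group_coset_eq [OF bilinear_relators_closed r]) simp
  also have "\<dots> = ?q (frag_of v) \<otimes>\<^bsub>M \<otimes>\<^sub>\<int> N\<^esub> ?q (frag_of w)"
    using hom_mult [OF F.coset_hom_Mod_generate [OF bilinear_relators_closed] c]
    unfolding tensor_group_def tensor_relations_def mult_free_Abelian_group .
  finally show ?thesis
    by (simp add: tensor_elem_def tensor_relations_def)
qed

lemma tensor_elem_mult_left:
  assumes "x \<in> carrier M" "x' \<in> carrier M" "y \<in> carrier N"
  shows "tensor_elem M N (x \<otimes>\<^bsub>M\<^esub> x') y = tensor_elem M N x y \<otimes>\<^bsub>M \<otimes>\<^sub>\<int> N\<^esub> tensor_elem M N x' y"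
proof -
  have "frag_of (x \<otimes>\<^bsub>M\<^esub> x', y) - (frag_of (x, y) + frag_of (x', y)) \<in> bilinear_relators"
    using assms unfolding diff_diff_eq [symmetric] by blast
  from tensor_relatorD [OF this] show ?thesis using assms by simp
qed

lemma tensor_elem_mult_right:
  assumes "x \<in> carrier M" "y \<in> carrier N" "y' \<in> carrier N"
  shows "tensor_elem M N x (y \<otimes>\<^bsub>N\<^esub> y') = tensor_elem M N x y \<otimes>\<^bsub>M \<otimes>\<^sub>\<int> N\<^esub> tensor_elem M N x y'"
proof -
  have "frag_of (x, y \<otimes>\<^bsub>N\<^esub> y') - (frag_of (x, y) + frag_of (x, y')) \<in> bilinear_relators"
    using assms unfolding diff_diff_eq [symmetric] by blast
  from tensor_relatorD [OF this] show ?thesis using assms by simp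
qed

text \<open>For fixed \<open>x\<close> the map sending \<open>y\<close> to its tensor with
  \<open>x\<close> is a homomorphism. This carries the sign relation of the second factor over to
  the tensor product.\<close>

lemma tensor_elem_inv_right:
  assumes "x \<in> carrier M" "y \<in> carrier N"
  shows "tensor_elem M N x (inv\<^bsub>N\<^esub> y) = inv\<^bsub>M \<otimes>\<^sub>\<int> N\<^esub> tensor_elem M N x y"
proof -
  have "tensor_elem M N x \<in> hom N (M \<otimes>\<^sub>\<int> N)"
    using assms by (intro homI tensor_elem_closed tensor_elem_mult_right) auto
  then interpret group_hom N "M \<otimes>\<^sub>\<int> N" "tensor_elem M N x"
    by (intro group_hom.intro group_hom_axioms.intro comm_group.axioms(2) [OF comm_group_tensor]
        N.group_axioms)
  show ?thesis using assms by simp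
qed

end

section \<open>Characters\<close>

lemma mult_char_group:
  "\<chi> \<otimes>\<^bsub>char_group G\<^esub> \<psi> = (\<lambda>x\<in>carrier G. \<chi> x * \<psi> x)"
  by (simp add: char_group_def)

lemma one_char_group: "\<one>\<^bsub>char_group G\<^esub> = (\<lambda>x\<in>carrier G. 1)"
  by (simp add: char_group_def)

lemma carrier_char_group_iff:
  "\<chi> \<in> carrier (char_group G) \<longleftrightarrow> \<chi> \<in> extensional (carrier G) \<and>
     (\<forall>x\<in>carrier G. \<chi> x \<noteq> 0) \<and>
     (\<forall>x\<in>carrier G. \<forall>y\<in>carrier G. \<chi> (x \<otimes>\<^bsub>G\<^esub> y) = \<chi> x * \<chi> y)"
  by (auto simp: char_group_def hom_def complex_units_def)

lemma comm_group_char_group: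
  assumes "monoid G"
  shows "comm_group (char_group G)"
proof -
  interpret monoid G by fact
  show ?thesis
  proof (rule comm_groupI)
    fix \<chi> assume "\<chi> \<in> carrier (char_group G)"
    then show "\<exists>\<psi>\<in>carrier (char_group G). \<psi> \<otimes>\<^bsub>char_group G\<^esub> \<chi> = \<one>\<^bsub>char_group G\<^esub>"
      by (intro bexI [of _ "\<lambda>x\<in>carrier G. inverse (\<chi> x)"])
        (auto simp: mult_char_group one_char_group carrier_char_group_iff)
    show "\<one>\<^bsub>char_group G\<^esub> \<otimes>\<^bsub>char_group G\<^esub> \<chi> = \<chi>"
      using \<open>\<chi> \<in> carrier (char_group G)\<close>
      by (auto simp: mult_char_group one_char_group carrier_char_group_iff fun_eq_iff extensional_def)
  qed (auto simp: mult_char_group one_char_group carrier_char_group_iff fun_eq_iff)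
qed

lemma dual_map_hom:
  assumes "monoid G" "f \<in> hom G H"
  shows "dual_map G f \<in> hom (char_group H) (char_group G)"
  using assms
  by (intro homI) (auto simp: dual_map_def mult_char_group carrier_char_group_iff fun_eq_iff
      hom_in_carrier hom_mult monoid.m_closed)

lemma inj_on_dual_map:
  assumes "f ` carrier G = carrier H"
  shows "inj_on (dual_map G f) (carrier (char_group H))"
proof (rule inj_onI)
  fix \<chi> \<psi> assume c: "\<chi> \<in> carrier (char_group H)" "\<psi> \<in> carrier (char_group H)"
    and eq: "dual_map G f \<chi> = dual_map G f \<psi>"
  have "\<chi> (f x) = \<psi> (f x)" if "x \<in> carrier G" for x
    using fun_cong [OF eq, of x] that by (simp add: dual_map_def)
  then have "\<chi> y = \<psi> y" if "y \<in> carrier H" for y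
    using that unfolding assms [symmetric] by auto
  then show "\<chi> = \<psi>"
    using c by (intro extensionalityI [of _ "carrier H"]) (auto simp: carrier_char_group_iff)
qed

text \<open>Divisibility of the nonzero complex numbers, the property of the target on which the
  extension of characters rests.\<close>

lemma complex_root_exists:
  assumes "0 < m"
  obtains z :: complex where "z ^ m = c"
proof
  show "rcis (root m (cmod c)) (Arg c / real m) ^ m = c"
    using assms by (simp add: DeMoivre2 rcis_cmod_Arg)
qed

text \<open>Adjoin \<open>g\<close> to \<open>H\<close>: with \<open>m\<close> the least positive
  exponent such that \<open>g [^] m\<close> lies in \<open>H\<close>, choose an \<open>m\<close>-th
  root \<open>z\<close> of the value of the character there and send
  \<open>h \<otimes> g [^] k\<close> to \<open>\<chi> h * z ^ k\<close>. Natural exponents suffice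
  because \<open>g\<close> has finite order.\<close>

lemma (in comm_group) character_extension_step:
  fixes \<chi> :: "'a \<Rightarrow> complex"
  assumes fin: "finite (carrier G)" and H: "subgroup H G" and g: "g \<in> carrier G - H"
    and nz: "\<And>x. x \<in> H \<Longrightarrow> \<chi> x \<noteq> 0"
    and hom: "\<And>x y. x \<in> H \<Longrightarrow> y \<in> H \<Longrightarrow> \<chi> (x \<otimes> y) = \<chi> x * \<chi> y"
  obtains K \<psi> where "subgroup K G" "H \<subset> K"
    "\<And>x. x \<in> H \<Longrightarrow> \<psi> x = \<chi> x" "\<And>x. x \<in> K \<Longrightarrow> \<psi> x \<noteq> 0"
    "\<And>x y. x \<in> K \<Longrightarrow> y \<in> K \<Longrightarrow> \<psi> (x \<otimes> y) = \<psi> x * \<psi> y"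
proof -
  interpret H: subgroup H G by fact
  have gG [simp]: "g \<in> carrier G" and gH: "g \<notin> H" using g by auto
  have HG [simp]: "h \<in> carrier G" if "h \<in> H" for h using that H.subset by blast
  define m where "m = (LEAST m :: nat. 0 < m \<and> g [^] m \<in> H)"
  have pos: "0 < Coset.order G" using fin by (simp add: order_gt_0_iff_finite)
  then have "0 < Coset.order G \<and> g [^] Coset.order G \<in> H" by (simp add: pow_order_eq_1)
  then have "0 < m \<and> g [^] m \<in> H" unfolding m_def by (rule LeastI)
  then have m: "0 < m" "g [^] m \<in> H" by auto
  have least: "m \<le> k" if "0 < k" "g [^] k \<in> H" for k
    unfolding m_def using that by (simp add: Least_le)
  have pow_Suc: "g [^] (m * Suc q) = g [^] m \<otimes> g [^] (m * q)" for q
    by (simp add: nat_pow_mult)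
  have pow_in: "g [^] (m * q) \<in> H" for q
    by (induction q) (simp_all add: pow_Suc m(2) del: mult_Suc_right)
  \<comment> \<open>Division with remainder: the remainder is again such an exponent and is below
    the least positive one.\<close>
  have dvd: "m dvd d" if d: "g [^] d \<in> H" for d
  proof -
    have "g [^] d = g [^] (m * (d div m)) \<otimes> g [^] (d mod m)"
      by (simp add: nat_pow_mult)
    then have "g [^] (d mod m) = inv (g [^] (m * (d div m))) \<otimes> g [^] d"
      by (simp add: inv_solve_left)
    then have "g [^] (d mod m) \<in> H" using d pow_in by simp
    moreover have "d mod m < m" using m(1) by simp
    ultimately have "d mod m = 0" using least [of "d mod m"] by linarith
    then show ?thesis by auto
  qed
  obtain z where z: "z ^ m = \<chi> (g [^] m)" using complex_root_exists [OF m(1)] .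
  have z0: "z \<noteq> 0" using z nz [OF m(2)] m(1) by (metis power_0_left less_irrefl)
  have one: "\<chi> \<one> = 1" using hom [of \<one> \<one>] nz [of \<one>] by simp
  have chi_pow: "\<chi> (g [^] (m * q)) = z ^ (m * q)" for q
  proof (induction q)
    case (Suc q)
    then show ?case unfolding pow_Suc using hom [OF m(2) pow_in] z by (simp add: power_add)
  qed (simp add: one)
  \<comment> \<open>Independence of the representation. The assumption \<open>k \<le> l\<close>
    allows \<open>g [^] k\<close> to be cancelled within natural exponents; \<open>wd\<close>
    removes it by symmetry.\<close>
  have le: "\<chi> h * z ^ k = \<chi> h' * z ^ l"
    if h: "h \<in> H" "h' \<in> H" and eq: "h \<otimes> g [^] k = h' \<otimes> g [^] l" and kl: "k \<le> l" for h h' k l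
  proof -
    have "h \<otimes> g [^] k = (h' \<otimes> g [^] (l - k)) \<otimes> g [^] k"
      using h kl eq by (simp add: m_assoc nat_pow_mult)
    then have e: "h = h' \<otimes> g [^] (l - k)" using h by simp
    then have "g [^] (l - k) = inv h' \<otimes> h" using h by (simp add: inv_solve_left)
    then have gH: "g [^] (l - k) \<in> H" using h by simp
    then obtain q where q: "l - k = m * q" using dvd by blast
    have "\<chi> h = \<chi> h' * z ^ (l - k)" using e hom [OF h(2) gH] chi_pow [of q] q by simp
    then show ?thesis using kl by (simp flip: power_add)
  qed
  have wd: "\<chi> h * z ^ k = \<chi> h' * z ^ l"
    if "h \<in> H" "h' \<in> H" "h \<otimes> g [^] k = h' \<otimes> g [^] l" for h h' k l
    using le [of h h' k l] le [of h' h l k] that by (metis nat_le_linear)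
  define K where "K = {h \<otimes> g [^] (k :: nat) | h k. h \<in> H}"
  define \<psi> where "\<psi> x = (THE v. \<exists>h\<in>H. \<exists>k. x = h \<otimes> g [^] (k :: nat) \<and> v = \<chi> h * z ^ k)" for x
  have psi: "\<psi> (h \<otimes> g [^] k) = \<chi> h * z ^ k" if "h \<in> H" for h k
    unfolding \<psi>_def
  proof (rule the_equality)
    show "\<exists>h'\<in>H. \<exists>k'. h \<otimes> g [^] k = h' \<otimes> g [^] (k' :: nat) \<and> \<chi> h * z ^ k = \<chi> h' * z ^ k'"
      using that by blast
  next
    fix v assume "\<exists>h'\<in>H. \<exists>l. h \<otimes> g [^] k = h' \<otimes> g [^] (l :: nat) \<and> v = \<chi> h' * z ^ l"
    then obtain h' l where "h' \<in> H" "h \<otimes> g [^] k = h' \<otimes> g [^] (l :: nat)" "v = \<chi> h' * z ^ l"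
      by blast
    then show "v = \<chi> h * z ^ k" using wd [OF that] by simp
  qed
  have mult: "(h \<otimes> g [^] k) \<otimes> (h' \<otimes> g [^] l) = (h \<otimes> h') \<otimes> g [^] (k + l)"
    if "h \<in> H" "h' \<in> H" for h h' and k l :: nat
    using that by (simp add: nat_pow_mult [symmetric] m_ac)
  have K_I: "h \<otimes> g [^] k \<in> K" if "h \<in> H" for h and k :: nat
    unfolding K_def using that by blast
  show thesis
  proof
    show "subgroup K G"
    proof (rule subgroupI)
      show "K \<subseteq> carrier G" by (auto simp: K_def)
      show "K \<noteq> {}" using K_I [OF H.one_closed] by blast
    next
      fix x y assume "x \<in> K" "y \<in> K"
      then obtain h k h' l where "h \<in> H" "h' \<in> H" "x = h \<otimes> g [^] (k :: nat)" "y = h' \<otimes> g [^] (l :: nat)"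
        unfolding K_def by blast
      then show "x \<otimes> y \<in> K" by (simp only: mult K_I H.m_closed)
    next
      fix x assume "x \<in> K"
      then obtain h k where h: "h \<in> H" "x = h \<otimes> g [^] (k :: nat)"
        unfolding K_def by blast
      \<comment> \<open>A natural exponent standing for \<open>-k\<close>: the order is positive, so
        the subtraction is exact and \<open>k + l\<close> is a multiple of the order.\<close>
      define l where "l = k * Coset.order G - k"
      have "k + l = Coset.order G * k" using pos by (simp add: l_def)
      then have "g [^] (k + l) = \<one>"
        by (simp add: nat_pow_pow [symmetric] pow_order_eq_1)
      then have "x \<otimes> (inv h \<otimes> g [^] l) = \<one>"
        using h by (simp add: mult)
      then have "inv x = inv h \<otimes> g [^] l"
        using h by (intro inv_equality) (simp_all add: m_comm)
      then show "inv x \<in> K" using h by (simp only: K_I H.m_inv_closed)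
    qed
    have "h \<in> K" if "h \<in> H" for h using K_I [OF that, of 0] that by simp
    moreover have "g \<in> K" using K_I [OF H.one_closed, of 1] by simp
    ultimately show "H \<subset> K" using gH by blast
    show "\<psi> x = \<chi> x" if "x \<in> H" for x using psi [OF that, of 0] that by simp
    show "\<psi> x \<noteq> 0" if "x \<in> K" for x
      using that nz z0 by (auto simp: K_def psi)
    show "\<psi> (x \<otimes> y) = \<psi> x * \<psi> y" if "x \<in> K" "y \<in> K" for x y
      using that by (auto simp: K_def mult psi hom power_add)
  qed
qed

text \<open>Induction on the number of elements outside \<open>H\<close>. The function is total but
  constrained only on \<open>H\<close>, so at the end it is merely cut down to an extensional
  one.\<close>

lemma (in comm_group) character_extension:
  fixes \<chi> :: "'a \<Rightarrow> complex"
  assumes fin: "finite (carrier G)" and H: "subgroup H G"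
    and nz: "\<And>x. x \<in> H \<Longrightarrow> \<chi> x \<noteq> 0"
    and hom: "\<And>x y. x \<in> H \<Longrightarrow> y \<in> H \<Longrightarrow> \<chi> (x \<otimes> y) = \<chi> x * \<chi> y"
  shows "\<exists>\<psi>\<in>carrier (char_group G). \<forall>x\<in>H. \<psi> x = \<chi> x"
  using H nz hom
proof (induction "card (carrier G - H)" arbitrary: H \<chi> rule: less_induct)
  case less
  show ?case
  proof (cases "H = carrier G")
    case True
    with less.prems show ?thesis
      by (intro bexI [of _ "restrict \<chi> (carrier G)"]) (auto simp: carrier_char_group_iff)
  next
    case False
    then obtain g where "g \<in> carrier G - H" using subgroup.subset [OF less.prems(1)] by blast
    from character_extension_step [where \<chi> = \<chi>, OF fin less.prems(1) this less.prems(2,3)]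
    obtain K \<psi> where K: "subgroup K G" "H \<subset> K"
      "\<And>x. x \<in> H \<Longrightarrow> \<psi> x = \<chi> x" "\<And>x. x \<in> K \<Longrightarrow> \<psi> x \<noteq> 0"
      "\<And>x y. x \<in> K \<Longrightarrow> y \<in> K \<Longrightarrow> \<psi> (x \<otimes> y) = \<psi> x * \<psi> y" by blast
    have "card (carrier G - K) < card (carrier G - H)"
      using K(1,2) subgroup.subset [OF K(1)] fin by (intro psubset_card_mono) auto
    from less.hyps [OF this K(1,4,5)] K(2,3) show ?thesis by (metis psubsetD)
  qed
qed

text \<open>A character of \<open>G\<close> is transported along the injection to the image subgroup
  of \<open>H\<close> and extended from there.\<close>

lemma dual_map_surj:
  assumes G: "group G" and H: "comm_group H" "finite (carrier H)" and f: "f \<in> mon G H"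
  shows "dual_map G f ` carrier (char_group H) = carrier (char_group G)"
proof
  interpret H: comm_group H by fact
  have hom: "f \<in> hom G H" and inj: "inj_on f (carrier G)" using f by (auto simp: mon_def)
  show "dual_map G f ` carrier (char_group H) \<subseteq> carrier (char_group G)"
    using dual_map_hom [OF group.is_monoid [OF G] hom] by (auto simp: hom_def)
  interpret f: group_hom G H f
    by (intro group_hom.intro group_hom_axioms.intro hom G H.group_axioms)
  show "carrier (char_group G) \<subseteq> dual_map G f ` carrier (char_group H)"
  proof
    fix \<chi> assume \<chi>: "\<chi> \<in> carrier (char_group G)"
    let ?g = "inv_into (carrier G) f"
    have g: "?g (f x) = x" if "x \<in> carrier G" for x using inj that by simp
    have "\<exists>\<psi>\<in>carrier (char_group H). \<forall>y\<in>f ` carrier G. \<psi> y = \<chi> (?g y)"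
    proof (rule H.character_extension [OF H(2) f.img_is_subgroup])
      fix y y' assume "y \<in> f ` carrier G" "y' \<in> f ` carrier G"
      then obtain x x' where x: "x \<in> carrier G" "x' \<in> carrier G" "y = f x" "y' = f x'" by blast
      then have "y \<otimes>\<^bsub>H\<^esub> y' = f (x \<otimes>\<^bsub>G\<^esub> x')" by simp
      then show "\<chi> (?g (y \<otimes>\<^bsub>H\<^esub> y')) = \<chi> (?g y) * \<chi> (?g y')"
        using x \<chi> by (simp only: g f.G.m_closed carrier_char_group_iff)
    next
      fix y assume "y \<in> f ` carrier G"
      then show "\<chi> (?g y) \<noteq> 0"
        using \<chi> g unfolding carrier_char_group_iff by force
    qed
    then obtain \<psi> where \<psi>: "\<psi> \<in> carrier (char_group H)" "\<And>x. x \<in> carrier G \<Longrightarrow> \<psi> (f x) = \<chi> x"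
      using g by auto
    then have "dual_map G f \<psi> = \<chi>"
      using \<chi> by (auto simp: dual_map_def carrier_char_group_iff fun_eq_iff extensional_def)
    then show "\<chi> \<in> dual_map G f ` carrier (char_group H)" using \<psi>(1) by blast
  qed
qed

section \<open>Symbols\<close>

lemma diff_closed_free_Abelian_group:
  "a \<in> carrier (free_Abelian_group S) \<Longrightarrow> b \<in> carrier (free_Abelian_group S) \<Longrightarrow>
    a - b \<in> carrier (free_Abelian_group S)"
  using keys_diff by fastforce

lemma hom_diff_free_Abelian_group:
  assumes "group T" "h \<in> hom (free_Abelian_group S) T"
    and "a \<in> carrier (free_Abelian_group S)" "b \<in> carrier (free_Abelian_group S)"
  shows "h (a - b) = h a \<otimes>\<^bsub>T\<^esub> inv\<^bsub>T\<^esub> h b"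
proof -
  interpret group_hom "free_Abelian_group S" T h
    by (intro group_hom.intro group_hom_axioms.intro assms group_free_Abelian_group)
  have "a - b = a \<otimes>\<^bsub>free_Abelian_group S\<^esub> inv\<^bsub>free_Abelian_group S\<^esub> b"
    using assms by simp
  then show ?thesis
    using hom_mult [OF assms(3) G.inv_closed [OF assms(4)]] hom_inv [OF assms(4)] by (simp only:)
qed

lemma hom_sum_free_Abelian_group:
  assumes "comm_group T" and h: "h \<in> hom (free_Abelian_group S) T"
    and s: "\<And>i. i \<in> I \<Longrightarrow> s i \<in> S"
  shows "h (\<Sum>i\<in>I. frag_of (s i)) = finprod T (\<lambda>i. h (frag_of (s i))) I"
proof -
  interpret T: comm_group T by fact
  interpret group_hom "free_Abelian_group S" T h
    by (intro group_hom.intro group_hom_axioms.intro h T.group_axioms group_free_Abelian_group)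
  have h0: "h 0 = \<one>\<^bsub>T\<^esub>" using hom_one by simp
  show ?thesis
    using s
  proof (induction I rule: infinite_finite_induct)
    case (insert i I)
    have c: "frag_of (s i) \<in> carrier (free_Abelian_group S)"
      "(\<Sum>i\<in>I. frag_of (s i)) \<in> carrier (free_Abelian_group S)"
      using insert.prems by (simp, intro sum_closed_free_Abelian_group, simp)
    have "h (\<Sum>i\<in>insert i I. frag_of (s i)) = h (frag_of (s i)) \<otimes>\<^bsub>T\<^esub> h (\<Sum>i\<in>I. frag_of (s i))"
      using insert.hyps hom_mult [OF c] by simp
    also have "\<dots> = finprod T (\<lambda>i. h (frag_of (s i))) (insert i I)"
      using insert by (subst T.finprod_insert) auto
    finally show ?case .
  qed (simp_all add: h0)
qed

lemma generating_tuples_mset_cong: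
  assumes "mset as = mset bs"
  shows "as \<in> generating_tuples n A \<longleftrightarrow> bs \<in> generating_tuples n A"
  using mset_eq_length [OF assms] mset_eq_setD [OF assms] by (simp add: generating_tuples_def)

lemma length_shift_entries [simp]: "length (shift_entries A as i) = length as"
  by (simp add: shift_entries_def)

text \<open>This and the next lemma separate the two roles of a leading entry: it is the pivot, or
  it is shifted by a later pivot. They drive the induction on the number of blown-up
  entries.\<close>

lemma shift_entries_Cons_0:
  "shift_entries A (x # as) 0 = x # map (\<lambda>y. y \<otimes>\<^bsub>A\<^esub> inv\<^bsub>A\<^esub> x) as"
  by (rule nth_equalityI) (auto simp: shift_entries_def nth_Cons' simp del: upt_Suc)

lemma shift_entries_Cons_Suc:
  "i < length as \<Longrightarrow> shift_entries A (x # as) (Suc i) = x \<otimes>\<^bsub>A\<^esub> inv\<^bsub>A\<^esub> (as ! i) # shift_entries A as i"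
  by (rule nth_equalityI) (auto simp: shift_entries_def nth_Cons' simp del: upt_Suc)

text \<open>Summands of different blow-up relations have to be compared only up to order; as a
  multiset a summand is its pivot together with the differences.\<close>

lemma mset_shift_entries:
  assumes "i < length as"
  shows "mset (shift_entries A as i) = add_mset (as ! i)
    (image_mset (\<lambda>j. as ! j \<otimes>\<^bsub>A\<^esub> inv\<^bsub>A\<^esub> (as ! i)) (mset_set ({..<length as} - {i})))"
proof -
  let ?f = "\<lambda>j. if j = i then as ! i else as ! j \<otimes>\<^bsub>A\<^esub> inv\<^bsub>A\<^esub> (as ! i)"
  have "mset (shift_entries A as i) = image_mset ?f (mset_set {..<length as})"
    by (simp add: shift_entries_def lessThan_atLeast0)
  also have "{..<length as} = insert i ({..<length as} - {i})"
    using assms by auto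
  also have "image_mset ?f (mset_set \<dots>) = add_mset (as ! i) (image_mset ?f (mset_set ({..<length as} - {i})))"
    by (subst mset_set.insert) simp_all
  also have "image_mset ?f (mset_set ({..<length as} - {i})) =
      image_mset (\<lambda>j. as ! j \<otimes>\<^bsub>A\<^esub> inv\<^bsub>A\<^esub> (as ! i)) (mset_set ({..<length as} - {i}))"
    by (rule image_mset_cong) auto
  finally show ?thesis .
qed

lemma (in group) shift_entries_closed:
  assumes "set as \<subseteq> carrier G" "i < length as"
  shows "set (shift_entries G as i) \<subseteq> carrier G"
  using assms by (auto simp: shift_entries_def subset_iff)

text \<open>The shift is invertible: the old entry is the new one times the pivot, which itself is
  unchanged. The set \<open>bs\<close> stands for the entries that are left alone.\<close>

lemma (in group) generate_shift_entries:
  assumes as: "set as \<subseteq> carrier G" and bs: "bs \<subseteq> carrier G" and i: "i < length as"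
  shows "generate G (set (shift_entries G as i) \<union> bs) = generate G (set as \<union> bs)"
proof -
  let ?s = "shift_entries G as i"
  have nth: "as ! j \<in> carrier G" if "j < length as" for j
    using as that by (auto simp: subset_iff)
  have s: "?s ! j = (if j = i then as ! i else as ! j \<otimes> inv (as ! i))" if "j < length as" for j
    using that by (simp add: shift_entries_def)
  have c: "set as \<union> bs \<subseteq> carrier G" "set ?s \<union> bs \<subseteq> carrier G"
    using as bs shift_entries_closed [OF as i] by auto
  have in1: "as ! j \<in> generate G (set as \<union> bs)" if "j < length as" for j
    using that by (intro generate.incl) simp
  have in2: "?s ! j \<in> generate G (set ?s \<union> bs)" if "j < length as" for j
    using that by (intro generate.incl) simp
  have i2: "as ! i \<in> generate G (set ?s \<union> bs)" using in2 [OF i] s [OF i] by simp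
  have "?s ! j \<in> generate G (set as \<union> bs)" if "j < length as" for j
    unfolding s [OF that] using in1 [OF that] in1 [OF i] generate_m_inv_closed [OF c(1)]
    by (simp add: generate.eng)
  then have 1: "set ?s \<union> bs \<subseteq> generate G (set as \<union> bs)"
    by (auto simp: set_conv_nth [of ?s] intro: generate.incl)
  have "as ! j \<in> generate G (set ?s \<union> bs)" if "j < length as" for j
  proof (cases "j = i")
    case False
    then have "as ! j = ?s ! j \<otimes> as ! i" using s that nth i by (simp add: m_assoc)
    then show ?thesis using generate.eng [OF in2 [OF that] i2] by simp
  qed (use i2 in simp)
  then have 2: "set as \<union> bs \<subseteq> generate G (set ?s \<union> bs)"
    by (auto simp: set_conv_nth [of as] intro: generate.incl)
  show ?thesis by (rule generate_eqI [OF c(2,1) 1 2])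
qed

lemma (in group) generating_tuples_shift_entries:
  assumes "as @ bs \<in> generating_tuples n G" "i < length as"
  shows "shift_entries G as i @ bs \<in> generating_tuples n G"
  using assms shift_entries_closed [of as i] generate_shift_entries [of as "set bs" i]
  by (simp add: generating_tuples_def)

text \<open>
  The relations (M) follow from their case \<open>k = 2\<close> by induction on \<open>k\<close>: expanding every summand of
  the relation for \<open>a\<^sub>1, \<dots>, a\<^sub>k\<close> along \<open>a\<^sub>i\<close> and a further entry \<open>x\<close> leaves the
  wanted summands with pivot \<open>a\<^sub>i\<close>, and the other terms add up, by the relation for
  \<open>a\<^sub>1 - x, \<dots>, a\<^sub>k - x\<close>, to the summand with pivot \<open>x\<close>.
\<close>

lemma blowup_relation_from_pairs:
  fixes f :: "'c list \<Rightarrow> 't"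
  assumes A: "comm_group A" and T: "comm_group T"
    and f: "\<And>as. as \<in> generating_tuples n A \<Longrightarrow> f as \<in> carrier T"
    and perm: "\<And>as bs. as \<in> generating_tuples n A \<Longrightarrow> mset as = mset bs \<Longrightarrow> f as = f bs"
    and pair: "\<And>a b cs. a # b # cs \<in> generating_tuples n A \<Longrightarrow>
      f (a # b # cs) = f (a # (b \<otimes>\<^bsub>A\<^esub> inv\<^bsub>A\<^esub> a) # cs) \<otimes>\<^bsub>T\<^esub> f ((a \<otimes>\<^bsub>A\<^esub> inv\<^bsub>A\<^esub> b) # b # cs)"
  shows "as \<noteq> [] \<Longrightarrow> as @ bs \<in> generating_tuples n A \<Longrightarrow>
    f (as @ bs) = finprod T (\<lambda>i. f (shift_entries A as i @ bs)) {..<length as}"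
proof (induction "length as" arbitrary: as bs)
  case (Suc k)
  interpret A: comm_group A by (rule A)
  interpret T: comm_group T by (rule T)
  note cong = generating_tuples_mset_cong [where n = n and A = A]
  obtain x as' where as: "as = x # as'" and k: "k = length as'"
    using Suc.hyps(2) by (cases as) auto
  have gt: "x # as' @ bs \<in> generating_tuples n A" using Suc.prems as by simp
  have xA: "x \<in> carrier A" and as'A: "set as' \<subseteq> carrier A"
    using gt by (auto simp: generating_tuples_def)
  \<comment> \<open>The induction starts at one entry, where the sum has a single term and the claim
    is trivial; this is why nonempty \<open>as\<close> is allowed although (M) begins at
    two.\<close>
  show ?case
  proof (cases "as' = []")
    case True
    then have "finprod T (\<lambda>i. f (shift_entries A as i @ bs)) {..<length as} = f (x # bs)"
      using f gt by (simp add: as shift_entries_Cons_0 lessThan_Suc Pi_def)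
    then show ?thesis using True as by simp
  next
    case False
    define ds where "ds = map (\<lambda>y. y \<otimes>\<^bsub>A\<^esub> inv\<^bsub>A\<^esub> x) as'"
    have ds: "length ds = k" "ds \<noteq> []" using False by (simp_all add: ds_def k)
    have gt1: "as' @ x # bs \<in> generating_tuples n A"
      using gt cong [of "as' @ x # bs" "x # as' @ bs"] by simp
    have s0: "shift_entries A as 0 = x # ds" by (simp add: as ds_def shift_entries_Cons_0)
    have sSuc: "shift_entries A as (Suc i) = x \<otimes>\<^bsub>A\<^esub> inv\<^bsub>A\<^esub> (as' ! i) # shift_entries A as' i" if "i < k" for i
      using that by (simp add: as k shift_entries_Cons_Suc)
    have gts: "shift_entries A as i @ bs \<in> generating_tuples n A" if "i < Suc k" for i
      using that gt by (intro A.generating_tuples_shift_entries) (simp_all add: as k)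
    have gt2: "ds @ x # bs \<in> generating_tuples n A"
      using gts [of 0] cong [of "ds @ x # bs" "x # ds @ bs"] by (simp add: s0)
    \<comment> \<open>The relation for the pair consisting of the pivot \<open>as' ! i\<close> and
      \<open>x\<close>, with \<open>r\<close> the remaining differences. The first term is the
      summand of \<open>as\<close> with the same pivot, the second a summand for \<open>ds\<close>
      with \<open>x\<close> kept among the unshifted entries.\<close>
    have step: "f (shift_entries A as' i @ x # bs) =
        f (shift_entries A as (Suc i) @ bs) \<otimes>\<^bsub>T\<^esub> f (shift_entries A ds i @ x # bs)"
      if i: "i < k" for i
    proof -
      let ?a = "as' ! i"
      have aA: "as' ! j \<in> carrier A" if "j < k" for j using as'A that k by (auto simp: subset_iff)
      obtain r where r: "mset r = image_mset (\<lambda>j. as' ! j \<otimes>\<^bsub>A\<^esub> inv\<^bsub>A\<^esub> ?a) (mset_set ({..<k} - {i}))"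
        using ex_mset by blast
      have m1: "mset (shift_entries A as' i) = add_mset ?a (mset r)"
        using mset_shift_entries [of i as' A] i by (simp add: r k)
      \<comment> \<open>Differences do not see the common shift by \<open>x\<close>, so the same
        \<open>r\<close> serves both sums.\<close>
      have cancel: "ds ! j \<otimes>\<^bsub>A\<^esub> inv\<^bsub>A\<^esub> (ds ! i) = as' ! j \<otimes>\<^bsub>A\<^esub> inv\<^bsub>A\<^esub> ?a" if "j < k" for j
        using that i aA [OF that] aA [OF i] xA
        by (simp add: ds_def k A.inv_mult_group A.m_assoc) (simp add: A.m_assoc [symmetric])
      have m2: "mset (shift_entries A ds i) = add_mset (?a \<otimes>\<^bsub>A\<^esub> inv\<^bsub>A\<^esub> x) (mset r)"
      proof -
        have "image_mset (\<lambda>j. ds ! j \<otimes>\<^bsub>A\<^esub> inv\<^bsub>A\<^esub> (ds ! i)) (mset_set ({..<k} - {i})) = mset r"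
          unfolding r by (rule image_mset_cong) (auto simp: cancel)
        then show ?thesis
          using mset_shift_entries [of i ds A] i by (simp add: ds(1)) (simp add: ds_def k)
      qed
      have gt3: "shift_entries A as' i @ x # bs \<in> generating_tuples n A"
        using gt1 i by (intro A.generating_tuples_shift_entries) (simp_all add: k)
      have gt4: "shift_entries A ds i @ x # bs \<in> generating_tuples n A"
        using gt2 i by (intro A.generating_tuples_shift_entries) (simp_all add: ds)
      have "f (shift_entries A as' i @ x # bs) = f (?a # x # r @ bs)"
        by (rule perm [OF gt3]) (simp add: m1)
      also have "\<dots> = f (?a # (x \<otimes>\<^bsub>A\<^esub> inv\<^bsub>A\<^esub> ?a) # r @ bs) \<otimes>\<^bsub>T\<^esub> f ((?a \<otimes>\<^bsub>A\<^esub> inv\<^bsub>A\<^esub> x) # x # r @ bs)"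
        using gt3 cong [of "shift_entries A as' i @ x # bs" "?a # x # r @ bs"]
        by (intro pair) (simp add: m1)
      also have "f (?a # (x \<otimes>\<^bsub>A\<^esub> inv\<^bsub>A\<^esub> ?a) # r @ bs) = f (shift_entries A as (Suc i) @ bs)"
        using i by (intro perm [OF gts, symmetric]) (simp_all add: sSuc m1)
      also have "f ((?a \<otimes>\<^bsub>A\<^esub> inv\<^bsub>A\<^esub> x) # x # r @ bs) = f (shift_entries A ds i @ x # bs)"
        by (rule perm [OF gt4, symmetric]) (simp add: m2)
      finally show ?thesis .
    qed
    have c1: "f (shift_entries A as i @ bs) \<in> carrier T" if "i < Suc k" for i
      using f gts that by blast
    have c2: "f (shift_entries A ds i @ x # bs) \<in> carrier T" if "i < k" for i
      using that gt2 ds by (intro f A.generating_tuples_shift_entries) simp_all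
    have "f (as @ bs) = f (as' @ x # bs)"
      unfolding as append_Cons by (rule perm [OF gt1, symmetric]) simp
    also have "\<dots> = finprod T (\<lambda>i. f (shift_entries A as' i @ x # bs)) {..<k}"
      using Suc.hyps(1) [OF k False gt1] k by simp
    also have "\<dots> = finprod T (\<lambda>i. f (shift_entries A as (Suc i) @ bs) \<otimes>\<^bsub>T\<^esub> f (shift_entries A ds i @ x # bs)) {..<k}"
      using c1 c2 by (intro T.finprod_cong') (auto simp: step)
    also have "\<dots> = finprod T (\<lambda>i. f (shift_entries A as (Suc i) @ bs)) {..<k} \<otimes>\<^bsub>T\<^esub>
        finprod T (\<lambda>i. f (shift_entries A ds i @ x # bs)) {..<k}"
      using c1 c2 by (intro T.finprod_multf) auto
    \<comment> \<open>The induction hypothesis a second time, read backwards; the result is the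
      summand of \<open>as\<close> with pivot \<open>x\<close>.\<close>
    also have "finprod T (\<lambda>i. f (shift_entries A ds i @ x # bs)) {..<k} = f (ds @ x # bs)"
      using Suc.hyps(1) [OF ds(1) [symmetric] ds(2) gt2] ds(1) by simp
    also have "\<dots> = f (shift_entries A as 0 @ bs)"
      by (rule perm [OF gt2]) (simp add: s0)
    also have "finprod T (\<lambda>i. f (shift_entries A as (Suc i) @ bs)) {..<k} =
        finprod T (\<lambda>i. f (shift_entries A as i @ bs)) (Suc ` {..<k})"
      using c1 by (intro T.finprod_reindex [symmetric]) auto
    also have "\<dots> \<otimes>\<^bsub>T\<^esub> f (shift_entries A as 0 @ bs) =
        finprod T (\<lambda>i. f (shift_entries A as i @ bs)) (insert 0 (Suc ` {..<k}))"
      using c1 by (subst T.finprod_insert) (auto intro!: T.m_comm T.finprod_closed)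
    also have "insert 0 (Suc ` {..<k}) = {..<length as}"
      using k by (simp add: as lessThan_Suc_eq_insert_0)
    finally show ?thesis .
  qed
qed simp

section \<open>Universal property of the group of symbols\<close>

lemma symbol_relators_closed:
  assumes "comm_group A"
  shows "perm_relators n A \<union> blowup_relators n A \<subseteq> carrier (free_Abelian_group (generating_tuples n A))"
proof -
  interpret A: comm_group A by fact
  let ?F = "free_Abelian_group (generating_tuples n A)"
  have "r \<in> carrier ?F" if "r \<in> perm_relators n A" for r
  proof -
    obtain \<sigma> as where r: "r = frag_of (permute_list \<sigma> as) - frag_of as"
      and \<sigma>: "\<sigma> permutes {..<n}" and as: "as \<in> generating_tuples n A"
      using \<open>r \<in> perm_relators n A\<close> unfolding perm_relators_def by blast
    have "length as = n" using as by (simp add: generating_tuples_def)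
    then have "permute_list \<sigma> as \<in> generating_tuples n A"
      using generating_tuples_mset_cong [OF mset_permute_list] \<sigma> as by metis
    then show ?thesis
      unfolding r using as by (intro diff_closed_free_Abelian_group frag_of_in_free_Abelian_group [THEN iffD2])
  qed
  moreover have "r \<in> carrier ?F" if "r \<in> blowup_relators n A" for r
  proof -
    obtain as bs where r: "r = frag_of (as @ bs) - (\<Sum>i<length as. frag_of (shift_entries A as i @ bs))"
      and as: "as @ bs \<in> generating_tuples n A"
      using \<open>r \<in> blowup_relators n A\<close> unfolding blowup_relators_def by blast
    show ?thesis
      unfolding r using as A.generating_tuples_shift_entries [OF as]
      by (intro diff_closed_free_Abelian_group sum_closed_free_Abelian_group
          frag_of_in_free_Abelian_group [THEN iffD2]) simp_all
  qed
  ultimately show ?thesis by blast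
qed

text \<open>Reduces a homomorphism out of \<open>\<M> n G\<close> to two checks: dependence on the
  multiset of entries only, which gives (S), and the relation for two entries, from which all of (M)
  follows.\<close>

lemma symbol_group_universal:
  fixes f :: "('g \<Rightarrow> complex) list \<Rightarrow> 't"
  assumes G: "monoid G" and T: "comm_group T"
    and f: "\<And>as. as \<in> generating_tuples n (char_group G) \<Longrightarrow> f as \<in> carrier T"
    and perm: "\<And>as bs. as \<in> generating_tuples n (char_group G) \<Longrightarrow> mset as = mset bs \<Longrightarrow> f as = f bs"
    and pair: "\<And>a b cs. a # b # cs \<in> generating_tuples n (char_group G) \<Longrightarrow>
      f (a # b # cs) = f (a # (b \<otimes>\<^bsub>char_group G\<^esub> inv\<^bsub>char_group G\<^esub> a) # cs) \<otimes>\<^bsub>T\<^esub>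
        f ((a \<otimes>\<^bsub>char_group G\<^esub> inv\<^bsub>char_group G\<^esub> b) # b # cs)"
  shows "\<exists>!D. D \<in> hom (\<M> n G) T \<and> D \<in> extensional (carrier (\<M> n G)) \<and>
    (\<forall>as\<in>generating_tuples n (char_group G). D (symbol n G as) = f as)"
  unfolding symbol_group_def symbol_def symbol_relations_def
proof (rule presentation_universal [OF T symbol_relators_closed f])
  let ?A = "char_group G"
  let ?F = "free_Abelian_group (generating_tuples n ?A)"
  show A: "comm_group ?A" by (rule comm_group_char_group [OF G])
  interpret A: comm_group ?A by (rule A)
  interpret T: comm_group T by (rule T)
  fix h r
  assume h: "h \<in> hom ?F T" and hf: "\<And>s. s \<in> generating_tuples n ?A \<Longrightarrow> h (frag_of s) = f s"
    and "r \<in> perm_relators n ?A \<union> blowup_relators n ?A"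
  then consider "r \<in> perm_relators n ?A" | "r \<in> blowup_relators n ?A" by blast
  then show "h r = \<one>\<^bsub>T\<^esub>"
  proof cases
    case 1
    then obtain \<sigma> as where r: "r = frag_of (permute_list \<sigma> as) - frag_of as"
      and \<sigma>: "\<sigma> permutes {..<n}" and as: "as \<in> generating_tuples n ?A"
      unfolding perm_relators_def by blast
    have "length as = n" using as by (simp add: generating_tuples_def)
    then have m: "mset (permute_list \<sigma> as) = mset as" using \<sigma> by simp
    then have as': "permute_list \<sigma> as \<in> generating_tuples n ?A"
      using generating_tuples_mset_cong as by metis
    have "h r = h (frag_of (permute_list \<sigma> as)) \<otimes>\<^bsub>T\<^esub> inv\<^bsub>T\<^esub> h (frag_of as)"
      unfolding r using as as'
      by (intro hom_diff_free_Abelian_group [OF T.group_axioms h] frag_of_in_free_Abelian_group [THEN iffD2])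
    then show ?thesis using perm [OF as' m] f [OF as] by (simp add: hf as as')
  next
    case 2
    then obtain as bs where r: "r = frag_of (as @ bs) - (\<Sum>i<length as. frag_of (shift_entries ?A as i @ bs))"
      and len: "2 \<le> length as" and as: "as @ bs \<in> generating_tuples n ?A"
      unfolding blowup_relators_def by blast
    have s: "shift_entries ?A as i @ bs \<in> generating_tuples n ?A" if "i \<in> {..<length as}" for i
      using that by (intro A.generating_tuples_shift_entries [OF as]) simp
    have "h r = h (frag_of (as @ bs)) \<otimes>\<^bsub>T\<^esub> inv\<^bsub>T\<^esub> h (\<Sum>i<length as. frag_of (shift_entries ?A as i @ bs))"
      unfolding r using as s
      by (intro hom_diff_free_Abelian_group [OF T.group_axioms h] sum_closed_free_Abelian_group
          frag_of_in_free_Abelian_group [THEN iffD2])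
    also have "h (\<Sum>i<length as. frag_of (shift_entries ?A as i @ bs)) =
        finprod T (\<lambda>i. h (frag_of (shift_entries ?A as i @ bs))) {..<length as}"
      using s by (rule hom_sum_free_Abelian_group [OF T h])
    also have "\<dots> = finprod T (\<lambda>i. f (shift_entries ?A as i @ bs)) {..<length as}"
      using s f hf by (intro T.finprod_cong') auto
    also have "\<dots> = f (as @ bs)"
      using len by (intro blowup_relation_from_pairs [OF A T f perm pair _ as, symmetric]) auto
    finally show ?thesis using f [OF as] by (simp add: hf as)
  qed
qed

lemma comm_group_symbol_group:
  "monoid G \<Longrightarrow> comm_group (\<M> n G)"
  unfolding symbol_group_def symbol_relations_def
  by (intro comm_group.comm_group_Mod_generate abelian_free_Abelian_group symbol_relators_closed
      comm_group_char_group)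

lemma symbol_relations_coset_hom:
  assumes "monoid G"
  shows "(\<lambda>x. symbol_relations n G #>\<^bsub>free_Abelian_group (generating_tuples n (char_group G))\<^esub> x)
    \<in> hom (free_Abelian_group (generating_tuples n (char_group G))) (\<M> n G)"
  unfolding symbol_group_def symbol_relations_def
  by (intro comm_group.coset_hom_Mod_generate abelian_free_Abelian_group symbol_relators_closed
      comm_group_char_group assms)

lemma symbol_closed:
  assumes "monoid G" "as \<in> generating_tuples n (char_group G)"
  shows "symbol n G as \<in> carrier (\<M> n G)"
  unfolding symbol_def using assms(2)
  by (intro hom_in_carrier [OF symbol_relations_coset_hom [OF assms(1)]]) simp

lemma symbol_relatorD:
  assumes "monoid G"
    and "u - v \<in> perm_relators n (char_group G) \<union> blowup_relators n (char_group G)"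
    and "v \<in> carrier (free_Abelian_group (generating_tuples n (char_group G)))"
  shows "symbol_relations n G #>\<^bsub>free_Abelian_group (generating_tuples n (char_group G))\<^esub> u =
    symbol_relations n G #>\<^bsub>free_Abelian_group (generating_tuples n (char_group G))\<^esub> v"
  unfolding symbol_relations_def
  by (intro free_Abelian_group_coset_eq symbol_relators_closed comm_group_char_group assms)

text \<open>Lists with equal multisets differ by a permutation of positions, so (S) becomes usable
  without naming one.\<close>

lemma symbol_mset_cong:
  assumes G: "monoid G" and bs: "bs \<in> generating_tuples n (char_group G)" and eq: "mset as = mset bs"
  shows "symbol n G as = symbol n G bs"
proof -
  obtain \<sigma> where \<sigma>: "\<sigma> permutes {..<length bs}" "permute_list \<sigma> bs = as"
    using mset_eq_permutation [OF eq] .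
  have "length bs = n" using bs by (simp add: generating_tuples_def)
  then have "frag_of as - frag_of bs \<in> perm_relators n (char_group G)"
    unfolding perm_relators_def using \<sigma> bs by auto
  then show ?thesis
    unfolding symbol_def using bs by (intro symbol_relatorD [OF G]) simp_all
qed

lemma symbol_pair:
  assumes G: "monoid G" and gt: "a # b # cs \<in> generating_tuples n (char_group G)"
  shows "symbol n G (a # b # cs) =
    symbol n G (a # (b \<otimes>\<^bsub>char_group G\<^esub> inv\<^bsub>char_group G\<^esub> a) # cs) \<otimes>\<^bsub>\<M> n G\<^esub>
    symbol n G ((a \<otimes>\<^bsub>char_group G\<^esub> inv\<^bsub>char_group G\<^esub> b) # b # cs)"
proof -
  let ?A = "char_group G"
  let ?F = "free_Abelian_group (generating_tuples n ?A)"
  interpret A: comm_group ?A by (rule comm_group_char_group [OF G])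
  define x where "x = a # (b \<otimes>\<^bsub>?A\<^esub> inv\<^bsub>?A\<^esub> a) # cs"
  define y where "y = (a \<otimes>\<^bsub>?A\<^esub> inv\<^bsub>?A\<^esub> b) # b # cs"
  have s: "shift_entries ?A [a, b] 0 @ cs = x" "shift_entries ?A [a, b] 1 @ cs = y"
    by (simp_all add: shift_entries_def x_def y_def)
  have "shift_entries ?A [a, b] j @ cs \<in> generating_tuples n ?A" if "j < 2" for j
    using gt that by (intro A.generating_tuples_shift_entries) simp_all
  from this [of 0] this [of 1] have xy: "frag_of x \<in> carrier ?F" "frag_of y \<in> carrier ?F"
    by (simp_all only: s) simp_all
  have "frag_of ([a, b] @ cs) - (\<Sum>j<length [a, b]. frag_of (shift_entries ?A [a, b] j @ cs))
      \<in> blowup_relators n ?A"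
    unfolding blowup_relators_def using gt by (intro CollectI exI [of _ "[a, b]"] exI [of _ cs]) simp
  also have "(\<Sum>j<length [a, b]. frag_of (shift_entries ?A [a, b] j @ cs)) = frag_of x + frag_of y"
    using s by (simp add: lessThan_Suc add.commute)
  finally have "frag_of (a # b # cs) - (frag_of x + frag_of y) \<in> blowup_relators n ?A" by simp
  then have "symbol n G (a # b # cs) = symbol_relations n G #>\<^bsub>?F\<^esub> (frag_of x + frag_of y)"
    unfolding symbol_def using comm_groupE(1) [OF abelian_free_Abelian_group xy]
    by (intro symbol_relatorD [OF G]) simp_all
  then show ?thesis
    using hom_mult [OF symbol_relations_coset_hom [OF G] xy] by (simp add: symbol_def x_def y_def)
qed

lemma generating_tuples_inv_Cons:
  assumes "group A" "a # as \<in> generating_tuples n A"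
  shows "inv\<^bsub>A\<^esub> a # as \<in> generating_tuples n A"
proof -
  interpret group A by fact
  have c: "a \<in> carrier A" "set as \<subseteq> carrier A" using assms(2) by (auto simp: generating_tuples_def)
  have "inv\<^bsub>A\<^esub> (inv\<^bsub>A\<^esub> a) \<in> generate A (set (inv\<^bsub>A\<^esub> a # as))"
    using c by (intro generate_m_inv_closed generate.incl) auto
  then have "set (a # as) \<subseteq> generate A (set (inv\<^bsub>A\<^esub> a # as))"
    using c by (auto intro: generate.incl)
  moreover have "set (inv\<^bsub>A\<^esub> a # as) \<subseteq> generate A (set (a # as))"
    by (auto intro: generate.incl generate.inv)
  ultimately have "generate A (set (inv\<^bsub>A\<^esub> a # as)) = generate A (set (a # as))"
    using c by (intro generate_eqI) auto
  then show ?thesis using assms(2) c by (simp add: generating_tuples_def)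
qed

section \<open>The quotient by the sign relation\<close>

context
  fixes G :: "('g, 'x) monoid_scheme" and n :: nat
  assumes G: "monoid G"
begin

interpretation M: comm_group "\<M> n G" by (rule comm_group_symbol_group [OF G])

private abbreviation (input) "minus_relators \<equiv>
  {symbol n G (inv\<^bsub>char_group G\<^esub> a # as) \<otimes>\<^bsub>\<M> n G\<^esub> symbol n G (a # as) | a as.
    a # as \<in> generating_tuples n (char_group G)}"

private lemma minus_relators_closed: "minus_relators \<subseteq> carrier (\<M> n G)"
proof
  fix u assume "u \<in> minus_relators"
  then obtain a as where u: "u = symbol n G (inv\<^bsub>char_group G\<^esub> a # as) \<otimes>\<^bsub>\<M> n G\<^esub> symbol n G (a # as)"
    and gt: "a # as \<in> generating_tuples n (char_group G)" by blast
  show "u \<in> carrier (\<M> n G)"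
    unfolding u
    by (intro M.m_closed symbol_closed G gt generating_tuples_inv_Cons comm_group.axioms(2)
        comm_group_char_group)
qed

lemma comm_group_minus_symbol_group: "comm_group (\<M>\<^sup>- n G)"
  unfolding minus_symbol_group_def minus_relations_def
  by (rule M.comm_group_Mod_generate [OF minus_relators_closed])

lemma minus_relations_coset_hom:
  "(\<lambda>x. minus_relations n G #>\<^bsub>\<M> n G\<^esub> x) \<in> hom (\<M> n G) (\<M>\<^sup>- n G)"
  unfolding minus_symbol_group_def minus_relations_def
  by (rule M.coset_hom_Mod_generate [OF minus_relators_closed])

lemma minus_symbol_closed:
  "as \<in> generating_tuples n (char_group G) \<Longrightarrow> minus_symbol n G as \<in> carrier (\<M>\<^sup>- n G)"
  unfolding minus_symbol_def
  by (intro hom_in_carrier [OF minus_relations_coset_hom] symbol_closed G)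

lemma minus_symbol_mset_cong:
  "bs \<in> generating_tuples n (char_group G) \<Longrightarrow> mset as = mset bs \<Longrightarrow>
    minus_symbol n G as = minus_symbol n G bs"
  unfolding minus_symbol_def by (rule arg_cong [OF symbol_mset_cong [OF G]])

lemma minus_symbol_pair:
  assumes gt: "a # b # cs \<in> generating_tuples n (char_group G)"
  shows "minus_symbol n G (a # b # cs) =
    minus_symbol n G (a # (b \<otimes>\<^bsub>char_group G\<^esub> inv\<^bsub>char_group G\<^esub> a) # cs) \<otimes>\<^bsub>\<M>\<^sup>- n G\<^esub>
    minus_symbol n G ((a \<otimes>\<^bsub>char_group G\<^esub> inv\<^bsub>char_group G\<^esub> b) # b # cs)"
proof -
  let ?A = "char_group G"
  interpret A: comm_group ?A by (rule comm_group_char_group [OF G])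
  have "shift_entries ?A [a, b] j @ cs \<in> generating_tuples n ?A" if "j < 2" for j
    using gt that by (intro A.generating_tuples_shift_entries) simp_all
  from this [of 0] this [of 1] have
    "a # (b \<otimes>\<^bsub>?A\<^esub> inv\<^bsub>?A\<^esub> a) # cs \<in> generating_tuples n ?A"
    "(a \<otimes>\<^bsub>?A\<^esub> inv\<^bsub>?A\<^esub> b) # b # cs \<in> generating_tuples n ?A"
    by (simp_all add: shift_entries_def)
  then show ?thesis
    unfolding minus_symbol_def symbol_pair [OF G gt]
    by (intro hom_mult [OF minus_relations_coset_hom] symbol_closed G)
qed

text \<open>The product of the two symbols is one of the defining relators, so its coset is trivial
  and the classes are inverse to each other.\<close>

lemma minus_symbol_inv_Cons:
  assumes gt: "a # as \<in> generating_tuples n (char_group G)"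
  shows "minus_symbol n G (inv\<^bsub>char_group G\<^esub> a # as) = inv\<^bsub>\<M>\<^sup>- n G\<^esub> minus_symbol n G (a # as)"
proof -
  let ?A = "char_group G"
  interpret N: comm_group "\<M>\<^sup>- n G" by (rule comm_group_minus_symbol_group)
  have gt': "inv\<^bsub>?A\<^esub> a # as \<in> generating_tuples n ?A"
    by (intro generating_tuples_inv_Cons comm_group.axioms(2) comm_group_char_group G gt)
  let ?r = "symbol n G (inv\<^bsub>?A\<^esub> a # as) \<otimes>\<^bsub>\<M> n G\<^esub> symbol n G (a # as)"
  have r: "?r \<in> minus_relations n G"
    unfolding minus_relations_def using gt by (intro generate.incl) blast
  have sub: "subgroup (minus_relations n G) (\<M> n G)"
    unfolding minus_relations_def by (rule M.generate_is_subgroup [OF minus_relators_closed])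
  have "minus_symbol n G (inv\<^bsub>?A\<^esub> a # as) \<otimes>\<^bsub>\<M>\<^sup>- n G\<^esub> minus_symbol n G (a # as) =
      minus_relations n G #>\<^bsub>\<M> n G\<^esub> ?r"
    unfolding minus_symbol_def
    by (intro hom_mult [OF minus_relations_coset_hom, symmetric] symbol_closed G gt gt')
  also have "\<dots> = minus_relations n G"
    by (rule M.coset_join2 [OF subgroup.mem_carrier [OF sub r] sub r])
  also have "\<dots> = \<one>\<^bsub>\<M>\<^sup>- n G\<^esub>" by (simp add: minus_symbol_group_def)
  finally show ?thesis
    by (intro N.inv_equality [symmetric] minus_symbol_closed gt gt')
qed

end

section \<open>Sums over subdivisions\<close>

text \<open>The product of \<open>g U V\<close> over all ways of distributing the entries, in order,
  to a left list \<open>U\<close> and a right list \<open>V\<close>. The recursion changes the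
  function rather than the index set, so two steps on \<open>a # b # cs\<close> leave a product over
  splittings of \<open>cs\<close> whose factor collects the four placements of \<open>a\<close> and
  \<open>b\<close>.\<close>

primrec split_prod :: "('t, 'x) monoid_scheme \<Rightarrow> ('c list \<Rightarrow> 'c list \<Rightarrow> 't) \<Rightarrow> 'c list \<Rightarrow> 't" where
  "split_prod T g [] = g [] []"
| "split_prod T g (a # as) = split_prod T (\<lambda>U V. g (a # U) V \<otimes>\<^bsub>T\<^esub> g U (a # V)) as"

text \<open>Equality is demanded only for complementary parts of \<open>as\<close>; this lets the
  entries of \<open>U\<close> and \<open>V\<close> be assumed to be characters later on.\<close>

lemma split_prod_cong:
  assumes "\<And>U V. mset U + mset V = mset as \<Longrightarrow> g U V = h U V"
  shows "split_prod T g as = split_prod T h as"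
  using assms
proof (induction as arbitrary: g h)
  case Nil
  show ?case using Nil [of "[]" "[]"] by simp
next
  case (Cons a as)
  show ?case
    unfolding split_prod.simps
  proof (rule Cons.IH)
    fix U V assume "mset U + mset V = mset as"
    then show "g (a # U) V \<otimes>\<^bsub>T\<^esub> g U (a # V) = h (a # U) V \<otimes>\<^bsub>T\<^esub> h U (a # V)"
      using Cons.prems [of "a # U" V] Cons.prems [of U "a # V"] by simp
  qed
qed

lemma (in comm_monoid) split_prod_closed:
  "(\<And>U V. g U V \<in> carrier G) \<Longrightarrow> split_prod G g as \<in> carrier G"
  by (induction as arbitrary: g) simp_all

lemma (in comm_monoid) split_prod_mult:
  assumes "\<And>U V. g U V \<in> carrier G" "\<And>U V. h U V \<in> carrier G"
  shows "split_prod G (\<lambda>U V. g U V \<otimes> h U V) as = split_prod G g as \<otimes> split_prod G h as"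
  using assms
proof (induction as arbitrary: g h)
  case (Cons a as)
  have "split_prod G (\<lambda>U V. g U V \<otimes> h U V) (a # as) =
      split_prod G (\<lambda>U V. (g (a # U) V \<otimes> g U (a # V)) \<otimes> (h (a # U) V \<otimes> h U (a # V))) as"
    using Cons.prems by (simp add: m_ac)
  also have "\<dots> = split_prod G g (a # as) \<otimes> split_prod G h (a # as)"
    using Cons.prems by (simp add: Cons.IH)
  finally show ?case .
qed simp

text \<open>Exchanging two neighbouring entries permutes the four placements and swaps entries
  inside \<open>U\<close> or inside \<open>V\<close>; commutativity and the invariance of
  \<open>g\<close> absorb both.\<close>

lemma (in comm_monoid) split_prod_move:
  assumes "\<And>U V. g U V \<in> carrier G"
    and "\<And>U U' V V'. mset U = mset U' \<Longrightarrow> mset V = mset V' \<Longrightarrow> g U V = g U' V'"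
  shows "split_prod G g (bs @ a # cs) = split_prod G g (a # bs @ cs)"
  using assms
proof (induction bs arbitrary: g)
  case Nil
  show ?case by simp
next
  case (Cons b bs)
  have swap: "g (a # b # U) V = g (b # a # U) V" "g U (a # b # V) = g U (b # a # V)" for U V
    by (rule Cons.prems(2); simp)+
  let ?h = "\<lambda>U V. g (b # U) V \<otimes> g U (b # V)"
  have "split_prod G ?h (bs @ a # cs) = split_prod G ?h (a # bs @ cs)"
  proof (rule Cons.IH)
    show "?h U V = ?h U' V'" if "mset U = mset U'" "mset V = mset V'" for U U' V V'
      using that Cons.prems(2) [of "b # U" "b # U'" V V'] Cons.prems(2) [of U U' "b # V" "b # V'"] by simp
  qed (use Cons.prems(1) in simp)
  then show ?case using Cons.prems(1) by (simp add: swap m_ac)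
qed

lemma (in comm_monoid) split_prod_mset_cong:
  assumes "\<And>U V. g U V \<in> carrier G"
    and "\<And>U U' V V'. mset U = mset U' \<Longrightarrow> mset V = mset V' \<Longrightarrow> g U V = g U' V'"
    and "mset as = mset bs"
  shows "split_prod G g as = split_prod G g bs"
  using assms
proof (induction as arbitrary: g bs)
  case Nil
  show ?case using Nil(3) by simp
next
  case (Cons a as)
  have "a \<in> set bs" using mset_eq_setD [OF Cons.prems(3)] by auto
  then obtain cs ds where bs: "bs = cs @ a # ds" by (meson split_list)
  let ?h = "\<lambda>U V. g (a # U) V \<otimes> g U (a # V)"
  have "split_prod G ?h as = split_prod G ?h (cs @ ds)"
  proof (rule Cons.IH)
    show "?h U V = ?h U' V'" if "mset U = mset U'" "mset V = mset V'" for U U' V V'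
      using that Cons.prems(2) [of "a # U" "a # U'" V V'] Cons.prems(2) [of U U' "a # V" "a # V'"] by simp
    show "mset as = mset (cs @ ds)" using Cons.prems(3) by (simp add: bs)
  qed (use Cons.prems(1) in simp)
  moreover have "split_prod G g bs = split_prod G g (a # cs @ ds)"
    unfolding bs by (rule split_prod_move [OF Cons.prems(1,2)])
  ultimately show ?case by simp
qed

text \<open>A set of positions contains \<open>0\<close> or not, and the rest is a shifted set: the
  counterpart on index sets of one recursion step of \<open>split_prod\<close>.\<close>

lemma (in comm_monoid) finprod_Pow_lessThan_Suc:
  assumes g: "\<And>J. g J \<in> carrier G"
  shows "finprod G g (Pow {..<Suc n}) =
    finprod G (\<lambda>J. g (insert 0 (Suc ` J)) \<otimes> g (Suc ` J)) (Pow {..<n})"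
proof -
  have inj: "inj_on (image Suc) (Pow {..<n})" by (rule inj_onI) (simp add: inj_image_eq_iff)
  have inj': "inj_on (\<lambda>J. insert 0 (Suc ` J)) (Pow {..<n})"
  proof (rule inj_onI)
    fix J K :: "nat set" assume "insert 0 (Suc ` J) = insert 0 (Suc ` K)"
    then have "Suc ` J = Suc ` K" by (metis Diff_insert_absorb image_iff nat.distinct(1))
    then show "J = K" by (simp add: inj_image_eq_iff)
  qed
  have "Pow {..<Suc n} = (\<lambda>J. insert 0 (Suc ` J)) ` Pow {..<n} \<union> image Suc ` Pow {..<n}"
    using image_Pow_surj [OF refl, of Suc "{..<n}"]
    by (simp add: lessThan_Suc_eq_insert_0 Pow_insert Un_commute image_image [symmetric])
  then have "finprod G g (Pow {..<Suc n}) =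
      finprod G g ((\<lambda>J. insert 0 (Suc ` J)) ` Pow {..<n}) \<otimes> finprod G g (image Suc ` Pow {..<n})"
    using g by (simp only:) (rule finprod_Un_disjoint, auto)
  also have "\<dots> = finprod G (\<lambda>J. g (insert 0 (Suc ` J))) (Pow {..<n}) \<otimes> finprod G (\<lambda>J. g (Suc ` J)) (Pow {..<n})"
    using g inj inj' by (simp add: finprod_reindex)
  also have "\<dots> = finprod G (\<lambda>J. g (insert 0 (Suc ` J)) \<otimes> g (Suc ` J)) (Pow {..<n})"
    using g by (intro finprod_multf [symmetric]) auto
  finally show ?thesis .
qed

text \<open>\<open>J\<close> is the set of positions sent to the right. The complement may be taken
  in all natural numbers, since \<open>nths\<close> ignores positions past the end.\<close>

lemma (in comm_monoid) split_prod_eq_finprod: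
  "(\<And>U V. g U V \<in> carrier G) \<Longrightarrow>
    split_prod G g as = finprod G (\<lambda>J. g (nths as (- J)) (nths as J)) (Pow {..<length as})"
proof (induction as arbitrary: g)
  case (Cons a as)
  have s: "{j. j \<notin> J} = - J" "{j. Suc j \<notin> Suc ` J} = - J" for J :: "nat set"
    by auto
  have n: "nths (a # as) (Suc ` J) = nths as J" "nths (a # as) (- (Suc ` J)) = a # nths as (- J)"
    "nths (a # as) (insert 0 (Suc ` J)) = a # nths as J"
    "nths (a # as) (- insert 0 (Suc ` J)) = nths as (- J)" for J
    by (simp_all add: nths_Cons inj_image_mem_iff s)
  have "split_prod G g (a # as) =
      finprod G (\<lambda>J. g (a # nths as (- J)) (nths as J) \<otimes> g (nths as (- J)) (a # nths as J)) (Pow {..<length as})"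
    using Cons by simp
  also have "\<dots> = finprod G (\<lambda>J. g (nths as (- J)) (a # nths as J) \<otimes> g (a # nths as (- J)) (nths as J)) (Pow {..<length as})"
    using Cons.prems by (intro finprod_cong') (auto simp: m_comm)
  also have "\<dots> = finprod G (\<lambda>J. g (nths (a # as) (- J)) (nths (a # as) J)) (Pow {..<length (a # as)})"
    using finprod_Pow_lessThan_Suc [of "\<lambda>J. g (nths (a # as) (- J)) (nths (a # as) J)"] Cons.prems
    by (simp add: n)
  finally show ?case .
qed (simp add: Pi_def)

lemma (in group) generate_pair:
  assumes "a \<in> carrier G" "b \<in> carrier G" "S \<subseteq> carrier G"
  shows "generate G (insert a (insert (b \<otimes> inv a) S)) = generate G (insert a (insert b S))"
    and "generate G (insert (a \<otimes> inv b) (insert b S)) = generate G (insert a (insert b S))"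
  using generate_shift_entries [of "[a, b]" S 0] generate_shift_entries [of "[a, b]" S 1] assms
  by (simp_all add: shift_entries_def)

lemma (in group) generate_insert_inv:
  assumes "a \<in> carrier G" "S \<subseteq> carrier G"
  shows "generate G (insert (inv a) S) = generate G (insert a S)"
proof (rule generate_eqI)
  have "inv (inv a) \<in> generate G (insert (inv a) S)"
    using assms by (intro generate_m_inv_closed generate.incl) auto
  then show "insert a S \<subseteq> generate G (insert (inv a) S)"
    using assms by (auto intro: generate.incl)
  show "insert (inv a) S \<subseteq> generate G (insert a S)"
    by (auto intro: generate.incl generate.inv)
qed (use assms in auto)

section \<open>The comultiplication\<close>

locale character_sequence =
  fixes G' :: "('a, 'x) monoid_scheme" and G :: "('b, 'y) monoid_scheme"
    and G'' :: "('c, 'z) monoid_scheme"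
    and i :: "'a \<Rightarrow> 'b" and p :: "'b \<Rightarrow> 'c" and n' n'' :: nat
  assumes group_G': "group G'" and comm_group_G: "comm_group G" and finite_G: "finite (carrier G)"
    and group_G'': "group G''"
    and i_mon: "i \<in> mon G' G" and p_epi: "p \<in> epi G G''" and exact: "kernel G G'' p = i ` carrier G'"
begin

abbreviation "A' \<equiv> char_group G'"
abbreviation "A \<equiv> char_group G"
abbreviation "A'' \<equiv> char_group G''"
abbreviation "res \<equiv> dual_map G' i"
abbreviation "incl \<equiv> dual_map G p"
abbreviation "B \<equiv> incl ` carrier A''"
abbreviation "lift \<equiv> inv_into (carrier A'') incl"
abbreviation "T \<equiv> \<M> n' G' \<otimes>\<^sub>\<int> \<M>\<^sup>- n'' G''"

lemma monoids: "monoid G'" "monoid G" "monoid G''"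
  using group_G' comm_group_G group_G'' by (simp_all add: group.is_monoid comm_group.axioms)

sublocale A': comm_group A' by (rule comm_group_char_group [OF monoids(1)])
sublocale A: comm_group A by (rule comm_group_char_group [OF monoids(2)])
sublocale A'': comm_group A'' by (rule comm_group_char_group [OF monoids(3)])

sublocale res: group_hom A A' res
  using i_mon by (intro group_hom.intro group_hom_axioms.intro dual_map_hom monoids A.group_axioms A'.group_axioms)
    (simp add: mon_def)
sublocale incl: group_hom A'' A incl
  using p_epi by (intro group_hom.intro group_hom_axioms.intro dual_map_hom monoids A.group_axioms A''.group_axioms)
    (simp add: epi_def)
sublocale M: comm_group "\<M> n' G'" by (rule comm_group_symbol_group [OF monoids(1)])
sublocale N: comm_group "\<M>\<^sup>- n'' G''" by (rule comm_group_minus_symbol_group [OF monoids(3)])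
sublocale T: comm_group T by (rule comm_group_tensor [OF M.comm_group_axioms N.comm_group_axioms])

lemma res_surj: "res ` carrier A = carrier A'"
  by (rule dual_map_surj [OF group_G' comm_group_G finite_G i_mon])

lemma incl_inj: "inj_on incl (carrier A'')"
  using p_epi by (intro inj_on_dual_map) (simp add: epi_def)

lemma B_subgroup: "subgroup B A"
  by (rule incl.img_is_subgroup)

lemma B_closed: "b \<in> B \<Longrightarrow> b \<in> carrier A"
  by (rule subgroup.mem_carrier [OF B_subgroup])

lemma lift_closed: "b \<in> B \<Longrightarrow> lift b \<in> carrier A''"
  by (simp add: inv_into_into)

lemma incl_lift: "b \<in> B \<Longrightarrow> incl (lift b) = b"
  by (simp add: f_inv_into_f)

lemma lift_mult:
  assumes "b \<in> B" "c \<in> B"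
  shows "lift (b \<otimes>\<^bsub>A\<^esub> c) = lift b \<otimes>\<^bsub>A''\<^esub> lift c"
proof (rule inv_into_f_eq [OF incl_inj])
  show "incl (lift b \<otimes>\<^bsub>A''\<^esub> lift c) = b \<otimes>\<^bsub>A\<^esub> c"
    using assms by (simp add: lift_closed incl_lift)
qed (use assms in \<open>simp add: lift_closed\<close>)

lemma lift_inv:
  assumes "b \<in> B"
  shows "lift (inv\<^bsub>A\<^esub> b) = inv\<^bsub>A''\<^esub> lift b"
proof (rule inv_into_f_eq [OF incl_inj])
  show "incl (inv\<^bsub>A''\<^esub> lift b) = inv\<^bsub>A\<^esub> b"
    using assms by (simp add: lift_closed incl_lift)
qed (use assms in \<open>simp add: lift_closed\<close>)

text \<open>The half of exactness of the dual sequence that says that \<open>B\<close> restricts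
  trivially: \<open>p\<close> kills the image of \<open>i\<close>.\<close>

lemma res_B:
  assumes "b \<in> B"
  shows "res b = \<one>\<^bsub>A'\<^esub>"
proof -
  obtain \<chi> where \<chi>: "\<chi> \<in> carrier A''" and b: "b = incl \<chi>" using assms by blast
  have i: "i x \<in> carrier G" if "x \<in> carrier G'" for x
    using i_mon that by (auto simp: mon_def hom_def)
  have "p (i x) = \<one>\<^bsub>G''\<^esub>" if "x \<in> carrier G'" for x
    using exact that unfolding kernel_def by blast
  moreover have "\<chi> \<one>\<^bsub>G''\<^esub> = 1"
  proof -
    have "\<one>\<^bsub>G''\<^esub> \<in> carrier G''" "\<one>\<^bsub>G''\<^esub> \<otimes>\<^bsub>G''\<^esub> \<one>\<^bsub>G''\<^esub> = \<one>\<^bsub>G''\<^esub>"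
      using monoids(3) by (simp_all add: monoid.one_closed monoid.l_one)
    then show ?thesis using \<chi> unfolding carrier_char_group_iff by (metis mult_cancel_right1)
  qed
  ultimately show ?thesis
    using i by (simp add: b dual_map_def one_char_group fun_eq_iff)
qed

text \<open>The conditions on a subdivision in terms of the two lists. Joint generation of
  \<open>A\<close> is included because \<open>U\<close> and \<open>V\<close> are here arbitrary
  lists; for the parts of a generating tuple it is automatic.\<close>

definition admissible :: "('b \<Rightarrow> complex) list \<Rightarrow> ('b \<Rightarrow> complex) list \<Rightarrow> bool" where
  "admissible U V \<longleftrightarrow> length U = n' \<and> length V = n'' \<and> set U \<subseteq> carrier A \<and> set V \<subseteq> B \<and>
     generate A (set U \<union> set V) = carrier A \<and> generate A (set V) = B"

text \<open>The neutral default lets the product run over all splittings, whatever the entries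
  are.\<close>

definition split_term where
  "split_term U V = (if admissible U V
     then tensor_elem (\<M> n' G') (\<M>\<^sup>- n'' G'') (symbol n' G' (map res U)) (minus_symbol n'' G'' (map lift V))
     else \<one>\<^bsub>T\<^esub>)"

text \<open>Restriction is onto, so the images of \<open>U\<close> and \<open>V\<close> generate
  \<open>A'\<close>, and those of \<open>V\<close> are trivial.\<close>

lemma admissible_res:
  assumes "admissible U V"
  shows "map res U \<in> generating_tuples n' A'"
proof -
  have U: "set U \<subseteq> carrier A" and V: "set V \<subseteq> B" and gen: "generate A (set U \<union> set V) = carrier A"
    using assms by (auto simp: admissible_def)
  have c: "res ` set U \<subseteq> carrier A'" using U by auto
  have UV: "set U \<union> set V \<subseteq> carrier A" using U V B_closed by blast
  have "carrier A' = generate A' (res ` (set U \<union> set V))"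
    by (simp only: res.generate_img [OF UV] gen res_surj)
  also have "\<dots> \<subseteq> generate A' (res ` set U)"
  proof (rule A'.generate_subgroup_incl [OF _ A'.generate_is_subgroup [OF c]])
    have "res v \<in> generate A' (res ` set U)" if "v \<in> set V" for v
      using res_B that V generate.one by (metis subsetD)
    then show "res ` (set U \<union> set V) \<subseteq> generate A' (res ` set U)"
      by (auto intro: generate.incl)
  qed
  finally have "generate A' (res ` set U) = carrier A'"
    using A'.generate_incl [OF c] by blast
  then show ?thesis
    using assms c by (simp add: generating_tuples_def admissible_def)
qed

text \<open>Applying \<open>incl\<close> to the subgroup generated by the lifts gives all of
  \<open>B\<close>; injectivity of \<open>incl\<close> turns this into equality in
  \<open>A''\<close>.\<close>

lemma admissible_lift:
  assumes "admissible U V"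
  shows "map lift V \<in> generating_tuples n'' A''"
proof -
  have V: "set V \<subseteq> B" and gen: "generate A (set V) = B"
    using assms by (auto simp: admissible_def)
  have c: "lift ` set V \<subseteq> carrier A''" using V lift_closed by blast
  have "incl ` lift ` set V = set V"
    using V by (simp add: image_image incl_lift subset_iff cong: image_cong_simp)
  then have "incl ` generate A'' (lift ` set V) = incl ` carrier A''"
    using incl.generate_img [OF c] gen by simp
  then have "generate A'' (lift ` set V) = carrier A''"
    using inj_on_image_eq_iff [OF incl_inj A''.generate_incl [OF c]] by simp
  then show ?thesis
    using assms c by (simp add: generating_tuples_def admissible_def)
qed

lemma split_term_closed: "split_term U V \<in> carrier T"
  by (simp add: split_term_def tensor_elem_closed [OF M.comm_group_axioms N.comm_group_axioms]
      symbol_closed monoids minus_symbol_closed admissible_res admissible_lift)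

lemma split_term_mset_cong:
  assumes "mset U = mset U'" "mset V = mset V'"
  shows "split_term U V = split_term U' V'"
proof -
  have adm: "admissible U V \<longleftrightarrow> admissible U' V'"
    using mset_eq_setD [OF assms(1)] mset_eq_setD [OF assms(2)]
      mset_eq_length [OF assms(1)] mset_eq_length [OF assms(2)] by (simp add: admissible_def)
  show ?thesis
  proof (cases "admissible U' V'")
    case True
    have "symbol n' G' (map res U) = symbol n' G' (map res U')"
      using assms by (intro symbol_mset_cong monoids admissible_res [OF True]) simp
    moreover have "minus_symbol n'' G'' (map lift V) = minus_symbol n'' G'' (map lift V')"
      using assms by (intro minus_symbol_mset_cong monoids admissible_lift [OF True]) simp
    ultimately show ?thesis using True adm by (simp add: split_term_def)
  next
    case False
    then show ?thesis using adm by (simp add: split_term_def)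
  qed
qed

section \<open>The placements of two entries \<open>a\<close>, \<open>b\<close> over a fixed
  splitting of the others\<close>

context
  fixes a b U V
  assumes a: "a \<in> carrier A" and b: "b \<in> carrier A"
    and U: "set U \<subseteq> carrier A" and V: "set V \<subseteq> carrier A"
begin

lemma admissible_pair_left:
  "admissible (a # (b \<otimes>\<^bsub>A\<^esub> inv\<^bsub>A\<^esub> a) # U) V \<longleftrightarrow> admissible (a # b # U) V"
  "admissible ((a \<otimes>\<^bsub>A\<^esub> inv\<^bsub>A\<^esub> b) # b # U) V \<longleftrightarrow> admissible (a # b # U) V"
  using A.generate_pair [OF a b, of "set U \<union> set V"] a b U V by (simp_all add: admissible_def)

text \<open>As \<open>B\<close> is a subgroup, it contains both entries of one pair exactly when it
  contains both of the other.\<close>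

lemma admissible_pair_right:
  "admissible U (a # (b \<otimes>\<^bsub>A\<^esub> inv\<^bsub>A\<^esub> a) # V) \<longleftrightarrow> admissible U (a # b # V)"
  "admissible U ((a \<otimes>\<^bsub>A\<^esub> inv\<^bsub>A\<^esub> b) # b # V) \<longleftrightarrow> admissible U (a # b # V)"
proof -
  have "b \<otimes>\<^bsub>A\<^esub> inv\<^bsub>A\<^esub> a \<in> B \<longleftrightarrow> b \<in> B" if "a \<in> B"
    using that a b B_subgroup
    by (metis A.inv_closed A.inv_solve_right A.m_closed subgroup.m_closed subgroup.m_inv_closed)
  moreover have "a \<otimes>\<^bsub>A\<^esub> inv\<^bsub>A\<^esub> b \<in> B \<longleftrightarrow> a \<in> B" if "b \<in> B"
    using that a b B_subgroup
    by (metis A.inv_closed A.inv_solve_right A.m_closed subgroup.m_closed subgroup.m_inv_closed)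
  ultimately show
    "admissible U (a # (b \<otimes>\<^bsub>A\<^esub> inv\<^bsub>A\<^esub> a) # V) \<longleftrightarrow> admissible U (a # b # V)"
    "admissible U ((a \<otimes>\<^bsub>A\<^esub> inv\<^bsub>A\<^esub> b) # b # V) \<longleftrightarrow> admissible U (a # b # V)"
    using A.generate_pair [OF a b, of "set U \<union> set V"] A.generate_pair [OF a b, of "set V"] a b U V
    by (auto simp: admissible_def)
qed

lemma admissible_pair_mixed:
  "admissible ((a \<otimes>\<^bsub>A\<^esub> inv\<^bsub>A\<^esub> b) # U) (b # V) \<longleftrightarrow> admissible (a # U) (b # V)"
  using A.generate_pair [OF a b, of "set U \<union> set V"] a b U V
  by (simp add: admissible_def insert_commute)

text \<open>The two differences are inverse to each other, so the right lists generate the same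
  subgroup; jointly with the left lists both sides generate what \<open>a\<close>, \<open>b\<close>,
  \<open>U\<close>, \<open>V\<close> do.\<close>

lemma admissible_pair_swap:
  "admissible (b # U) ((a \<otimes>\<^bsub>A\<^esub> inv\<^bsub>A\<^esub> b) # V) \<longleftrightarrow> admissible (a # U) ((b \<otimes>\<^bsub>A\<^esub> inv\<^bsub>A\<^esub> a) # V)"
proof -
  have inv: "a \<otimes>\<^bsub>A\<^esub> inv\<^bsub>A\<^esub> b = inv\<^bsub>A\<^esub> (b \<otimes>\<^bsub>A\<^esub> inv\<^bsub>A\<^esub> a)"
    using a b by (simp add: A.inv_mult A.m_comm)
  have c: "b \<otimes>\<^bsub>A\<^esub> inv\<^bsub>A\<^esub> a \<in> carrier A" using a b by simp
  have "inv\<^bsub>A\<^esub> x \<in> B \<longleftrightarrow> x \<in> B" if "x \<in> carrier A" for x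
    using that subgroup.m_inv_closed [OF B_subgroup] by (metis A.inv_inv)
  moreover have "generate A (insert (a \<otimes>\<^bsub>A\<^esub> inv\<^bsub>A\<^esub> b) (insert b (set U \<union> set V))) =
      generate A (insert (b \<otimes>\<^bsub>A\<^esub> inv\<^bsub>A\<^esub> a) (insert a (set U \<union> set V)))"
    using A.generate_pair [OF a b, of "set U \<union> set V"] U V by (simp add: insert_commute)
  ultimately show ?thesis
    using a b U c A.generate_insert_inv [OF c V] by (simp add: admissible_def inv)
qed

lemma split_term_pair_left:
  "split_term (a # b # U) V =
    split_term (a # (b \<otimes>\<^bsub>A\<^esub> inv\<^bsub>A\<^esub> a) # U) V \<otimes>\<^bsub>T\<^esub> split_term ((a \<otimes>\<^bsub>A\<^esub> inv\<^bsub>A\<^esub> b) # b # U) V"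
proof (cases "admissible (a # b # U) V")
  case True
  have gt: "res a # res b # map res U \<in> generating_tuples n' A'"
    using admissible_res [OF True] by simp
  have gt': "res a # (res b \<otimes>\<^bsub>A'\<^esub> inv\<^bsub>A'\<^esub> res a) # map res U \<in> generating_tuples n' A'"
    "(res a \<otimes>\<^bsub>A'\<^esub> inv\<^bsub>A'\<^esub> res b) # res b # map res U \<in> generating_tuples n' A'"
    using admissible_res [of "a # (b \<otimes>\<^bsub>A\<^esub> inv\<^bsub>A\<^esub> a) # U" V]
      admissible_res [of "(a \<otimes>\<^bsub>A\<^esub> inv\<^bsub>A\<^esub> b) # b # U" V] True a b
    by (simp_all add: admissible_pair_left)
  show ?thesis
    using True a b gt gt' minus_symbol_closed [OF monoids(3) admissible_lift [OF True]]
    by (simp add: split_term_def admissible_pair_left symbol_pair [OF monoids(1) gt]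
        tensor_elem_mult_left [OF M.comm_group_axioms N.comm_group_axioms] symbol_closed monoids)
qed (simp add: split_term_def admissible_pair_left)

lemma split_term_pair_right:
  "split_term U (a # b # V) =
    split_term U (a # (b \<otimes>\<^bsub>A\<^esub> inv\<^bsub>A\<^esub> a) # V) \<otimes>\<^bsub>T\<^esub> split_term U ((a \<otimes>\<^bsub>A\<^esub> inv\<^bsub>A\<^esub> b) # b # V)"
proof (cases "admissible U (a # b # V)")
  case True
  then have ab: "a \<in> B" "b \<in> B" by (auto simp: admissible_def)
  have inv: "inv\<^bsub>A\<^esub> a \<in> B" "inv\<^bsub>A\<^esub> b \<in> B"
    using ab subgroup.m_inv_closed [OF B_subgroup] by blast+
  have l: "lift (b \<otimes>\<^bsub>A\<^esub> inv\<^bsub>A\<^esub> a) = lift b \<otimes>\<^bsub>A''\<^esub> inv\<^bsub>A''\<^esub> lift a"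
    "lift (a \<otimes>\<^bsub>A\<^esub> inv\<^bsub>A\<^esub> b) = lift a \<otimes>\<^bsub>A''\<^esub> inv\<^bsub>A''\<^esub> lift b"
    by (simp_all only: lift_mult lift_inv ab inv)
  have gt: "lift a # lift b # map lift V \<in> generating_tuples n'' A''"
    using admissible_lift [OF True] by simp
  have gt': "lift a # (lift b \<otimes>\<^bsub>A''\<^esub> inv\<^bsub>A''\<^esub> lift a) # map lift V \<in> generating_tuples n'' A''"
    "(lift a \<otimes>\<^bsub>A''\<^esub> inv\<^bsub>A''\<^esub> lift b) # lift b # map lift V \<in> generating_tuples n'' A''"
    using admissible_lift [of U "a # (b \<otimes>\<^bsub>A\<^esub> inv\<^bsub>A\<^esub> a) # V"]
      admissible_lift [of U "(a \<otimes>\<^bsub>A\<^esub> inv\<^bsub>A\<^esub> b) # b # V"] True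
    by (simp_all add: admissible_pair_right l)
  show ?thesis
    using True gt gt' symbol_closed [OF monoids(1) admissible_res [OF True]]
    by (simp add: split_term_def admissible_pair_right l minus_symbol_pair [OF monoids(3) gt]
        tensor_elem_mult_right [OF M.comm_group_axioms N.comm_group_axioms] minus_symbol_closed monoids)
qed (simp add: split_term_def admissible_pair_right)

text \<open>When the term is admissible, \<open>b\<close> lies in \<open>B\<close>, and subtracting
  it does not change the restriction of \<open>a\<close>.\<close>

lemma split_term_pair_mixed:
  "split_term ((a \<otimes>\<^bsub>A\<^esub> inv\<^bsub>A\<^esub> b) # U) (b # V) = split_term (a # U) (b # V)"
proof (cases "admissible (a # U) (b # V)")
  case True
  then have "b \<in> B" by (simp add: admissible_def)
  then have "res (a \<otimes>\<^bsub>A\<^esub> inv\<^bsub>A\<^esub> b) = res a" using a b res_B [of b] by simp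
  then show ?thesis by (simp add: split_term_def admissible_pair_mixed)
qed (simp add: split_term_def admissible_pair_mixed)

text \<open>Here the sign relation of \<open>\<M>\<^sup>-\<close> enters: \<open>a\<close> and \<open>b\<close> agree modulo \<open>A''\<close>.\<close>

lemma split_term_pair_swap:
  "split_term (a # U) ((b \<otimes>\<^bsub>A\<^esub> inv\<^bsub>A\<^esub> a) # V) \<otimes>\<^bsub>T\<^esub> split_term (b # U) ((a \<otimes>\<^bsub>A\<^esub> inv\<^bsub>A\<^esub> b) # V) = \<one>\<^bsub>T\<^esub>"
proof (cases "admissible (a # U) ((b \<otimes>\<^bsub>A\<^esub> inv\<^bsub>A\<^esub> a) # V)")
  case True
  let ?d = "b \<otimes>\<^bsub>A\<^esub> inv\<^bsub>A\<^esub> a"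
  have d: "?d \<in> B" using True by (simp add: admissible_def)
  have inv: "a \<otimes>\<^bsub>A\<^esub> inv\<^bsub>A\<^esub> b = inv\<^bsub>A\<^esub> ?d"
    using a b by (simp add: A.inv_mult A.m_comm)
  have "res b \<otimes>\<^bsub>A'\<^esub> inv\<^bsub>A'\<^esub> res a = \<one>\<^bsub>A'\<^esub>" using a b res_B [OF d] by simp
  then have res: "res b = res a"
    using a b by (metis A'.inv_solve_right A'.l_one A'.one_closed res.hom_closed)
  have gt: "lift ?d # map lift V \<in> generating_tuples n'' A''"
    using admissible_lift [OF True] by simp
  let ?x = "symbol n' G' (map res (a # U))" and ?y = "minus_symbol n'' G'' (map lift (?d # V))"
  have x: "?x \<in> carrier (\<M> n' G')" by (rule symbol_closed [OF monoids(1) admissible_res [OF True]])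
  have y: "?y \<in> carrier (\<M>\<^sup>- n'' G'')" by (rule minus_symbol_closed [OF monoids(3) admissible_lift [OF True]])
  have "minus_symbol n'' G'' (map lift (inv\<^bsub>A\<^esub> ?d # V)) = inv\<^bsub>\<M>\<^sup>- n'' G''\<^esub> ?y"
    using minus_symbol_inv_Cons [OF monoids(3) gt] by (simp only: list.map lift_inv [OF d])
  moreover have "map res (b # U) = map res (a # U)" by (simp only: list.map res)
  ultimately have "split_term (b # U) ((a \<otimes>\<^bsub>A\<^esub> inv\<^bsub>A\<^esub> b) # V) =
      inv\<^bsub>T\<^esub> (tensor_elem (\<M> n' G') (\<M>\<^sup>- n'' G'') ?x ?y)"
    using True tensor_elem_inv_right [OF M.comm_group_axioms N.comm_group_axioms x y]
    unfolding split_term_def admissible_pair_swap by (simp only: inv if_True)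
  moreover have "split_term (a # U) (?d # V) = tensor_elem (\<M> n' G') (\<M>\<^sup>- n'' G'') ?x ?y"
    using True unfolding split_term_def by (simp only: if_True)
  ultimately show ?thesis
    using T.r_inv [OF tensor_elem_closed [OF M.comm_group_axioms N.comm_group_axioms x y]] by (simp only:)
next
  case False
  then show ?thesis unfolding split_term_def admissible_pair_swap by simp
qed

end

lemma split_prod_pair:
  assumes "a # b # cs \<in> generating_tuples n A"
  shows "split_prod T split_term (a # b # cs) =
    split_prod T split_term (a # (b \<otimes>\<^bsub>A\<^esub> inv\<^bsub>A\<^esub> a) # cs) \<otimes>\<^bsub>T\<^esub>
    split_prod T split_term ((a \<otimes>\<^bsub>A\<^esub> inv\<^bsub>A\<^esub> b) # b # cs)"
proof -
  have a: "a \<in> carrier A" and b: "b \<in> carrier A" and cs: "set cs \<subseteq> carrier A"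
    using assms by (auto simp: generating_tuples_def)
  \<comment> \<open>The four placements of the two leading entries, bracketed as two steps of the
    recursion produce them, so that \<open>g\<close> below holds by unfolding.\<close>
  let ?g = "\<lambda>a b U V. (split_term (a # b # U) V \<otimes>\<^bsub>T\<^esub> split_term (b # U) (a # V)) \<otimes>\<^bsub>T\<^esub>
    (split_term (a # U) (b # V) \<otimes>\<^bsub>T\<^esub> split_term U (a # b # V))"
  let ?ba = "b \<otimes>\<^bsub>A\<^esub> inv\<^bsub>A\<^esub> a" and ?ab = "a \<otimes>\<^bsub>A\<^esub> inv\<^bsub>A\<^esub> b"
  have g: "split_prod T split_term (a # b # cs) = split_prod T (?g a b) cs" for a b
    by simp
  have "?g a b U V = ?g a ?ba U V \<otimes>\<^bsub>T\<^esub> ?g ?ab b U V" if UV: "mset U + mset V = mset cs" for U V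
  proof -
    have "set U \<union> set V = set cs" using UV by (metis set_mset_mset set_mset_union)
    then have U: "set U \<subseteq> carrier A" and V: "set V \<subseteq> carrier A" using cs by auto
    let ?x1 = "split_term (a # ?ba # U) V" and ?y1 = "split_term (?ab # b # U) V"
    let ?x2 = "split_term (a # U) (?ba # V)" and ?y2 = "split_term (?ab # U) (b # V)"
    let ?x3 = "split_term (?ba # U) (a # V)" and ?y3 = "split_term (b # U) (?ab # V)"
    let ?x4 = "split_term U (a # ?ba # V)" and ?y4 = "split_term U (?ab # b # V)"
    have "?g a b U V = ((?x1 \<otimes>\<^bsub>T\<^esub> ?y1) \<otimes>\<^bsub>T\<^esub> ?x3) \<otimes>\<^bsub>T\<^esub> (?y2 \<otimes>\<^bsub>T\<^esub> (?x4 \<otimes>\<^bsub>T\<^esub> ?y4))"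
      by (simp only: split_term_pair_left [OF a b U V] split_term_pair_right [OF a b U V]
          split_term_pair_mixed [OF a b U V] split_term_pair_mixed [OF b a U V])
    \<comment> \<open>Six of the eight terms of the right-hand side are present; the missing two are
      inserted as a product equal to the neutral element.\<close>
    also have "\<dots> = (((?x1 \<otimes>\<^bsub>T\<^esub> ?y1) \<otimes>\<^bsub>T\<^esub> ?x3) \<otimes>\<^bsub>T\<^esub> (?y2 \<otimes>\<^bsub>T\<^esub> (?x4 \<otimes>\<^bsub>T\<^esub> ?y4))) \<otimes>\<^bsub>T\<^esub> (?x2 \<otimes>\<^bsub>T\<^esub> ?y3)"
      unfolding split_term_pair_swap [OF a b U V] by (intro T.r_one [symmetric] T.m_closed split_term_closed)
    also have "\<dots> = ?g a ?ba U V \<otimes>\<^bsub>T\<^esub> ?g ?ab b U V"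
      by (simp only: T.m_ac T.m_closed split_term_closed)
    finally show ?thesis .
  qed
  then have "split_prod T (?g a b) cs = split_prod T (\<lambda>U V. ?g a ?ba U V \<otimes>\<^bsub>T\<^esub> ?g ?ab b U V) cs"
    by (rule split_prod_cong)
  also have "\<dots> = split_prod T (?g a ?ba) cs \<otimes>\<^bsub>T\<^esub> split_prod T (?g ?ab b) cs"
    by (intro T.split_prod_mult T.m_closed split_term_closed)
  finally show ?thesis by (simp only: g)
qed

text \<open>A subdivision is determined by its second part \<open>J\<close>, the first being the
  complement.\<close>

lemma Delta_symbol_eq_split_prod:
  assumes as: "as \<in> generating_tuples (n' + n'') A"
  shows "Delta_symbol n' n'' G' G G'' i p as = split_prod T split_term as"
proof -
  let ?n = "length as"
  let ?D = "{J \<in> Pow {..<?n}. admissible (nths as (- J)) (nths as J)}"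
  let ?h = "\<lambda>J. ({..<?n} - J, J)"
  let ?t = "\<lambda>(I', I''). tensor_elem (\<M> n' G') (\<M>\<^sup>- n'' G'')
    (symbol n' G' (map res (nths as I'))) (minus_symbol n'' G'' (map lift (nths as I'')))"
  have n: "?n = n' + n''" using as by (simp add: generating_tuples_def)
  have compl: "nths as ({..<?n} - J) = nths as (- J)" for J
    unfolding nths_def by (rule arg_cong [where f = "map fst"], rule filter_cong)
      (auto dest: set_zip_rightD)
  have set: "set (nths as J) = (!) as ` J" if "J \<subseteq> {..<?n}" for J
    using that by (auto simp: set_nths)
  have len: "length (nths as J) = card J" if "J \<subseteq> {..<?n}" for J
    unfolding length_nths using that by (intro arg_cong [where f = card]) auto
  have adm: "admissible (nths as (- J)) (nths as J) \<longleftrightarrow>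
      card ({..<?n} - J) = n' \<and> card J = n'' \<and> (\<forall>j\<in>J. as ! j \<in> B) \<and> generate A ((!) as ` J) = B"
    if J: "J \<subseteq> {..<?n}" for J
  proof -
    have "set (nths as ({..<?n} - J)) \<union> set (nths as J) = (!) as ` ({..<?n} - J \<union> J)"
      using set [OF J] set [of "{..<?n} - J"] by (simp only: image_Un Diff_subset)
    also have "{..<?n} - J \<union> J = {..<?n}" using J by blast
    also have "(!) as ` {..<?n} = set as" by (auto simp: set_conv_nth)
    finally have "set (nths as ({..<?n} - J)) \<union> set (nths as J) = set as" .
    moreover have "set as \<subseteq> carrier A" "generate A (set as) = carrier A"
      using as by (auto simp: generating_tuples_def)
    moreover from this have "set (nths as ({..<?n} - J)) \<subseteq> carrier A"
      using set_nths_subset by (metis subset_trans)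
    moreover have "length (nths as ({..<?n} - J)) = card ({..<?n} - J)" by (rule len) auto
    ultimately show ?thesis
      unfolding admissible_def compl [symmetric] using set [OF J] len [OF J]
      by (simp add: image_subset_iff)
  qed
  have sub: "subdivisions n' n'' A B as = ?h ` ?D"
  proof (intro equalityI subsetI)
    fix q assume "q \<in> subdivisions n' n'' A B as"
    then obtain I' I'' where q: "q = (I', I'')" "I' \<union> I'' = {..<?n}" "I' \<inter> I'' = {}" "card I' = n'"
      "card I'' = n''" "\<forall>j\<in>I''. as ! j \<in> B" "generate A ((!) as ` I'') = B"
      unfolding subdivisions_def by blast
    have I: "I'' \<subseteq> {..<?n}" "I' = {..<?n} - I''" using q(2,3) by auto
    then have "I'' \<in> ?D" using q(4-7) adm [OF I(1)] by simp
    then show "q \<in> ?h ` ?D" using q(1) I(2) by blast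
  next
    fix q assume "q \<in> ?h ` ?D"
    then obtain J where q: "q = ?h J" and J: "J \<subseteq> {..<?n}" "admissible (nths as (- J)) (nths as J)" by blast
    then show "q \<in> subdivisions n' n'' A B as"
      using adm [OF J(1)] unfolding q subdivisions_def by auto
  qed
  have t: "?t (?h J) = split_term (nths as (- J)) (nths as J)" if "J \<in> ?D" for J
    using that by (simp add: split_term_def compl)
  have tc: "?t (?h J) \<in> carrier T" if "J \<in> ?D" for J
    unfolding t [OF that] by (rule split_term_closed)
  have "Delta_symbol n' n'' G' G G'' i p as = finprod T ?t (?h ` ?D)"
    by (simp only: Delta_symbol_def sub)
  also have "\<dots> = finprod T (\<lambda>J. ?t (?h J)) ?D"
    using tc by (intro T.finprod_reindex) (blast, simp add: inj_on_def)
  \<comment> \<open>Enlarging the index set is harmless: every added \<open>J\<close> is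
    inadmissible and contributes the neutral element.\<close>
  also have "\<dots> = finprod T (\<lambda>J. split_term (nths as (- J)) (nths as J)) (Pow {..<?n})"
    using t split_term_closed
    by (intro T.finprod_mono_neutral_cong_left) (auto simp: split_term_def)
  also have "\<dots> = split_prod T split_term as"
    by (rule T.split_prod_eq_finprod [symmetric, OF split_term_closed])
  finally show ?thesis .
qed

end

theorem proposition9:
  fixes G' :: "('a, 'x) monoid_scheme"
    and G :: "('b, 'y) monoid_scheme"
    and G'' :: "('c, 'z) monoid_scheme"
    and i :: "'a \<Rightarrow> 'b" and p :: "'b \<Rightarrow> 'c"
    and n n' n'' :: nat
  assumes "comm_group G'" and "finite (carrier G')"
    and "comm_group G" and "finite (carrier G)"
    and "comm_group G''" and "finite (carrier G'')"
    and "i \<in> mon G' G" and "p \<in> epi G G''" and "kernel G G'' p = i ` carrier G'"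
    and "carrier G'' \<noteq> {\<one>\<^bsub>G''\<^esub>}"
    and "n = n' + n''" and "n' \<ge> 1" and "n'' \<ge> 1"
  shows "\<exists>!\<Delta>. \<Delta> \<in> hom (\<M> n G) (\<M> n' G' \<otimes>\<^sub>\<int> \<M>\<^sup>- n'' G'') \<and>
           \<Delta> \<in> extensional (carrier (\<M> n G)) \<and>
           (\<forall>as\<in>generating_tuples n (char_group G).
              \<Delta> (symbol n G as) = Delta_symbol n' n'' G' G G'' i p as)"
proof -
  interpret character_sequence G' G G'' i p n' n''
    using assms by (intro character_sequence.intro) (simp_all add: comm_group.axioms)
  have "\<exists>!\<Delta>. \<Delta> \<in> hom (\<M> n G) T \<and> \<Delta> \<in> extensional (carrier (\<M> n G)) \<and>
      (\<forall>as\<in>generating_tuples n (char_group G). \<Delta> (symbol n G as) = split_prod T split_term as)"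
    by (intro symbol_group_universal monoids T.comm_group_axioms T.split_prod_closed split_term_closed
        split_prod_pair T.split_prod_mset_cong split_term_mset_cong)
  \<comment> \<open>The two descriptions of the sum were identified only on generating tuples, so
    the replacement takes place under the bounded quantifier.\<close>
  then show ?thesis
    unfolding \<open>n = n' + n''\<close> by (simp add: Delta_symbol_eq_split_prod cong: ball_cong)
qed

end
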